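(* Let $s_1$ be a complex number such that either $\operatorname{Re} s_1 \le 0$, or $\operatorname{Re} s_1 > 0$ and $s_1$ is not an integer. Let $m_2, m_3 \ge 0$ be integers. For each integer $k \ge 0$ let $\bar{B}_k = B_k(1)$, where $B_k(\alpha)$ is the Bernoulli polynomial of degree $k$. Then $$\zeta_3(s_1, -m_2, -m_3) = \sum_{k_3=0}^{m_3+1} \binom{m_3+1}{k_3} \frac{\bar{B}_{k_3}}{m_3+1} \sum_{k_2=0}^{m_2+m_3+2-k_3} \binom{m_2+m_3+2-k_3}{k_2} \frac{\bar{B}_{k_2}}{m_2+m_3+2-k_3}\, \zeta\big(s_1 - (m_2+m_3+2-k_2-k_3)\big),$$ where $\zeta$ denotes the Riemann zeta function.
   Context: The Bernoulli polynomials $B_n(\alpha)$, $n \ge 0$, are defined by $\frac{z e^{\alpha z}}{e^z - 1} = \sum_{n\ge 0} \frac{B_n(\alpha)}{n!} z^n$ for $|z|<2\pi$. The multiple (triple) zeta function is defined by $$\zeta_3(s_1,s_2,s_3) = \sum_{n_1 \ge 1} n_1^{-s_1} \sum_{n_2 > n_1} n_2^{-s_2} \sum_{n_3 > n_2} n_3^{-s_3}$$ for $\operatorname{Re} s_1, \operatorname{Re} s_2 \ge 1$ and $\operatorname{Re} s_3 > 1$, and by its analytic (meromorphic) continuation in each variable otherwise. For integers $m_2,m_3\ge 0$ and complex $s_1$, the value $\zeta_3(s_1,-m_2,-m_3)$ is defined as the iterated limit $$\zeta_3(s_1,-m_2,-m_3) = \lim_{s_1' \to s_1} \lim_{s_2'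 \to -m_2} \lim_{s_3' \to -m_3} \zeta_3(s_1', s_2', s_3'),$$ where $s_1',s_2',s_3'$ are complex variables (the innermost limit is taken first). *)

theory Defs
  imports "HOL-Complex_Analysis.Complex_Analysis"
    "HOL-Computational_Algebra.Formal_Power_Series"
begin

text \<open>
  The generating function \<open>z e\<^sup>\<alpha>\<^sup>z / (e\<^sup>z - 1)\<close>, read as a formal power series. The denominator has
  zero constant term; the division of \<open>fps\<close> over a field cancels the common factor \<open>z\<close>.
\<close>

definition bernpoly :: "nat \<Rightarrow> complex \<Rightarrow> complex" where
  "bernpoly n \<alpha> = fact n * fps_nth (fps_X * fps_exp \<alpha> / (fps_exp 1 - 1)) n"

text \<open>
  The value at \<open>s\<close> of the analytic continuation is the common value at \<open>s\<close> of all holomorphic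
  functions that extend the Dirichlet series to a domain containing \<open>s\<close>. There is no such
  function at a pole, where the value is an unspecified complex number.
\<close>

definition riemann_zeta :: "complex \<Rightarrow> complex" where
  "riemann_zeta s = (THE v. \<exists>U g. open U \<and> connected U \<and> {t. Re t > 1} \<subseteq> U \<and> s \<in> U \<and>
     g holomorphic_on U \<and>
     (\<forall>t. Re t > 1 \<longrightarrow> g t = (\<Sum>\<^sub>\<infinity>n\<in>{1::nat..}. of_nat n powr (- t))) \<and> v = g s)"

definition zeta3_domain :: "(complex \<times> complex \<times> complex) set" where
  "zeta3_domain = {(s1, s2, s3). Re s1 \<ge> 1 \<and> Re s2 \<ge> 1 \<and> Re s3 > 1}"

definition zeta3_series :: "complex \<Rightarrow> complex \<Rightarrow> complex \<Rightarrow> complex" where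
  "zeta3_series s1 s2 s3 =
     (\<Sum>\<^sub>\<infinity>n1\<in>{1::nat..}. of_nat n1 powr (- s1) *
       (\<Sum>\<^sub>\<infinity>n2\<in>{n1<..}. of_nat n2 powr (- s2) *
         (\<Sum>\<^sub>\<infinity>n3\<in>{n2<..}. of_nat n3 powr (- s3))))"

text \<open>
  A function of three complex variables is holomorphic on an open set if it is continuous and
  complex differentiable in each variable separately.
\<close>

definition holomorphic3_on ::
  "(complex \<times> complex \<times> complex \<Rightarrow> complex) \<Rightarrow> (complex \<times> complex \<times> complex) set \<Rightarrow> bool" where
  "holomorphic3_on g U \<longleftrightarrow> continuous_on U g \<and>
     (\<forall>(a, b, c)\<in>U. (\<lambda>z. g (z, b, c)) field_differentiable at a \<and>
                    (\<lambda>z. g (a, z, c)) field_differentiable at b \<and>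
                    (\<lambda>z. g (a, b, z)) field_differentiable at c)"

text \<open>Unspecified on the polar set, like \<^const>\<open>riemann_zeta\<close>.\<close>

definition zeta3 :: "complex \<Rightarrow> complex \<Rightarrow> complex \<Rightarrow> complex" where
  "zeta3 s1 s2 s3 = (THE v. \<exists>U g. open U \<and> connected U \<and> zeta3_domain \<subseteq> U \<and> (s1, s2, s3) \<in> U \<and>
     holomorphic3_on g U \<and>
     (\<forall>(t1, t2, t3)\<in>zeta3_domain. g (t1, t2, t3) = zeta3_series t1 t2 t3) \<and>
     v = g (s1, s2, s3))"

text \<open>
  \<open>L\<close> is the limit of \<open>f x y z\<close> for \<open>z \<rightarrow> c\<close>, then \<open>y \<rightarrow> b\<close>, then \<open>x \<rightarrow> a\<close>, and all of these limits exist.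
  An inner limit is required only for the outer variables in a punctured neighbourhood
  (that of \<open>b\<close> may depend on \<open>x\<close>).
\<close>

definition has_iterated_limit ::
  "(complex \<Rightarrow> complex \<Rightarrow> complex \<Rightarrow> complex) \<Rightarrow> complex \<Rightarrow> complex \<Rightarrow> complex \<Rightarrow> complex \<Rightarrow> bool" where
  "has_iterated_limit f a b c L \<longleftrightarrow>
     (\<exists>g h. (\<forall>\<^sub>F x in at a. \<forall>\<^sub>F y in at b. ((\<lambda>z. f x y z) \<longlongrightarrow> g x y) (at c)) \<and>
            (\<forall>\<^sub>F x in at a. ((\<lambda>y. g x y) \<longlongrightarrow> h x) (at b)) \<and>
            (h \<longlongrightarrow> L) (at a))"

definition zeta3_nonpos :: "complex \<Rightarrow> nat \<Rightarrow> nat \<Rightarrow> complex" where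
  "zeta3_nonpos s1 m2 m3 =
     Lim (at s1) (\<lambda>x. Lim (at (- of_nat m2)) (\<lambda>y. Lim (at (- of_nat m3)) (\<lambda>z. zeta3 x y z)))"

end

(* The tail sum over n > N of n^(-s) has an Euler-Maclaurin expansion in the powers N^(1-s-k) whose
   coefficients are the B_k(1) binom(1-s, k) / (s-1), with a remainder that is holomorphic in s and
   as small as desired. Substituting it for the sum over n3 and then for the sum over n2 continues
   the triple zeta function to the complement of the hyperplanes s3 = 1, s2 + s3 = 2 - k and
   s1 + s2 + s3 = 3 - k, in terms of the Riemann zeta function and convergent series. This complement
   is connected, and it stays so inside every ball, hence the continuation is unique. At s = -m the
   expansion terminates and the remainder vanishes, so letting s3 tend to -m3 and then s2 to -m2
   leaves the asserted finite sum; its two factors -1 cancel. *)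
theory Submission
  imports Defs
begin

subsection \<open>Bernoulli numbers and Euler--Maclaurin coefficients\<close>

text \<open>The coefficients solve a difference equation. A tail sum F satisfies F(n - 1) - F(n) =
  n^(-s), that is (exp(-D) - 1) F = n^(-s) with D = d/dn. Formally F is - D / (1 - exp(-D)) applied
  to the antiderivative n^(1-s) / (1-s), and z / (1 - exp(-z)) = z exp(z) / (exp(z) - 1) generates
  the B_k(1). To make this rigorous, the truncated formal solution is put back into the difference
  equation and its defect is estimated by the binomial series; no integrals of periodic Bernoulli
  functions occur. The order of the limits matters: (s1, -m2, -m3) always lies on the hyperplane s2
  + s3 = 2 - k with k = m2 + m3 + 2. Setting s3 = -m3 kills the coefficients with k > m3 + 1, and in
  the surviving terms the second argument of the double zeta function tends to a non-positive
  integer as s2 tends to -m2, where for non-integral s1 it has no pole. The last limit is then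
  continuity of the Riemann zeta function. Since a value of the continuation is defined through
  arbitrary connected domains, uniqueness has to be proved against every competing domain.\<close>

lemma bernpoly_one_recurrence:
  "(\<Sum>k\<le>j. of_nat (Suc j choose k) * (-1) ^ (Suc j - k) * bernpoly k 1) = (if j = 0 then -1 else 0)"
proof -
  define G :: "complex fps" where "G = fps_X * fps_exp 1 / (fps_exp 1 - 1)"
  have ne: "fps_exp 1 - 1 \<noteq> (0 :: complex fps)"
  proof
    assume "fps_exp 1 - 1 = (0 :: complex fps)"
    hence "fps_nth (fps_exp 1 - 1) 1 = (0 :: complex)" by (simp only: fps_zero_nth)
    thus False by simp
  qed
  \<comment> \<open>Both series have order 1 at the origin, so the division in the definition of
    \<open>bernpoly\<close> is exact and can be undone by multiplication.\<close>
  have "(fps_exp 1 - 1 :: complex fps) dvd fps_X * fps_exp 1"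
  proof -
    have "subdegree (fps_exp 1 - 1 :: complex fps) = 1"
      by (rule subdegreeI) auto
    moreover have "subdegree (fps_X * fps_exp 1 :: complex fps) = 1"
      by (rule subdegreeI) auto
    moreover have "fps_X * fps_exp 1 \<noteq> (0 :: complex fps)"
      by simp
    ultimately show ?thesis using ne by (simp add: fps_dvd_iff)
  qed
  hence "G * (fps_exp 1 - 1) = fps_X * fps_exp 1"
    unfolding G_def by (simp add: dvd_div_mult_self)
  \<comment> \<open>The factor exp(-X) turns the divisor into 1 - exp(-X), the symbol of the
    backward difference. The recurrence is the coefficient of X^(j+1) in G (1 - exp(-X)) =
    X.\<close>
  hence "G * (fps_exp 1 - 1) * fps_exp (-1) = fps_X * (fps_exp 1 * fps_exp (-1))"
    by (simp add: mult_ac)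
  moreover have e: "fps_exp 1 * fps_exp (-1) = (1 :: complex fps)"
    by (simp flip: fps_exp_add_mult)
  ultimately have *: "G * (1 - fps_exp (-1)) = fps_X"
    by (simp add: algebra_simps)
  have "fps_nth (G * (1 - fps_exp (-1))) (Suc j) = (if j = 0 then 1 else 0)"
    by (subst *) (simp add: fps_X_def)
  also have "fps_nth (G * (1 - fps_exp (-1))) (Suc j) =
      (\<Sum>k\<le>j. fps_nth G k * (- ((-1) ^ (Suc j - k) / fact (Suc j - k))))"
    by (simp add: fps_mult_nth atLeast0AtMost atMost_Suc cong: sum.cong_simp)
  finally have "fact (Suc j) * (\<Sum>k\<le>j. fps_nth G k * (- ((-1) ^ (Suc j - k) / fact (Suc j - k))))
      = (if j = 0 then 1 else 0 :: complex)"
    by auto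
  also have "fact (Suc j) * (\<Sum>k\<le>j. fps_nth G k * (- ((-1) ^ (Suc j - k) / fact (Suc j - k)))) =
     - (\<Sum>k\<le>j. of_nat (Suc j choose k) * (-1) ^ (Suc j - k) * bernpoly k 1)"
    unfolding sum_distrib_left sum_negf[symmetric]
  proof (rule sum.cong[OF refl])
    fix k assume "k \<in> {..j}"
    hence "(of_nat (Suc j choose k) :: complex) = fact (Suc j) / (fact k * fact (Suc j - k))"
      by (intro binomial_fact) auto
    thus "fact (Suc j) * (fps_nth G k * (- ((-1) ^ (Suc j - k) / fact (Suc j - k)))) =
        - (of_nat (Suc j choose k) * (-1) ^ (Suc j - k) * bernpoly k 1)"
      by (simp add: bernpoly_def G_def)
  qed
  finally show ?thesis by (simp add: minus_equation_iff split: if_splits)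
qed

text \<open>
  The Euler--Maclaurin expansion of \<open>\<Sum>n>N. n powr -s\<close> is \<open>\<Sum>k. em_coeff k s * N powr (1 - s - k)\<close>.
  The value at the pole \<open>s = 1\<close> is junk.
\<close>
definition em_coeff :: "nat \<Rightarrow> complex \<Rightarrow> complex" where
  "em_coeff k s = bernpoly k 1 / (s - 1) * ((1 - s) gchoose k)"

text \<open>With 1 - s = m + 1 the generalised binomial coefficient is an ordinary one and vanishes
  for k > m + 1; this is what truncates the expansion. The sign comes from s - 1 = - (m +
  1).\<close>

lemma em_coeff_neg_nat:
  "em_coeff k (- of_nat m) = - (of_nat ((m + 1) choose k) * (bernpoly k 1 / of_nat (m + 1)))"
proof -
  have "(1 - (- of_nat m)) gchoose k = (of_nat ((m + 1) choose k) :: complex)"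
    by (simp add: binomial_gbinomial)
  moreover have "(- of_nat m - 1 :: complex) = - of_nat (m + 1)" by simp
  ultimately show ?thesis
    unfolding em_coeff_def by (metis divide_minus_right mult.commute mult_minus_left)
qed

lemma holomorphic_em_coeff [holomorphic_intros]:
  assumes "f holomorphic_on A" "\<And>z. z \<in> A \<Longrightarrow> f z \<noteq> 1"
  shows "(\<lambda>z. em_coeff k (f z)) holomorphic_on A"
  unfolding em_coeff_def gbinomial_prod_rev
  using assms by (intro holomorphic_intros) auto

text \<open>This is the difference equation up to order K, with x = 1/n and the factor n^(1-s)
  removed: the inner sum is the Taylor polynomial of (1 - x)^w - 1 for w = 1 - s - k, and the right
  side x stands for n^(-s). Its degree K - k is chosen so that exactly the powers x, ..., x^K occur.
  By trinomial revision the coefficient of x^j is binom(1 - s, j) / (s - 1) times the Bernoulli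
  recurrence, so only j = 1 survives.\<close>

lemma em_coeff_sum:
  assumes "s \<noteq> 1" "K \<ge> 1"
  shows "(\<Sum>k<K. em_coeff k s * x ^ k * (\<Sum>i=1..K-k. ((1 - s - of_nat k) gchoose i) * (-x) ^ i)) = x"
proof -
  have "(\<Sum>k<K. em_coeff k s * x ^ k * (\<Sum>i=1..K-k. ((1 - s - of_nat k) gchoose i) * (-x) ^ i)) =
      (\<Sum>k<K. \<Sum>j=Suc k..K. em_coeff k s * ((1 - s - of_nat k) gchoose (j - k)) * (-1) ^ (j - k) * x ^ j)"
  proof (intro sum.cong refl)
    fix k assume k: "k \<in> {..<K}"
    have "(\<Sum>i=1..K-k. ((1 - s - of_nat k) gchoose i) * (-x) ^ i) =
        (\<Sum>j=Suc k..K. ((1 - s - of_nat k) gchoose (j - k)) * (-x) ^ (j - k))"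
      by (rule sum.reindex_bij_witness[of _ "\<lambda>j. j - k" "\<lambda>i. i + k"]) (use k in auto)
    also have "em_coeff k s * x ^ k * \<dots> =
        (\<Sum>j=Suc k..K. em_coeff k s * ((1 - s - of_nat k) gchoose (j - k)) * (-1) ^ (j - k) * x ^ j)"
      unfolding sum_distrib_left
    proof (intro sum.cong refl)
      fix j assume "j \<in> {Suc k..K}"
      hence "x ^ j = x ^ k * x ^ (j - k)" by (simp flip: power_add)
      thus "em_coeff k s * x ^ k * (((1 - s - of_nat k) gchoose (j - k)) * (-x) ^ (j - k)) =
         em_coeff k s * ((1 - s - of_nat k) gchoose (j - k)) * (-1) ^ (j - k) * x ^ j"
        by (simp add: power_minus[of x] mult_ac)
    qed
    finally show "em_coeff k s * x ^ k * (\<Sum>i=1..K-k. ((1 - s - of_nat k) gchoose i) * (-x) ^ i) =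
      (\<Sum>j=Suc k..K. em_coeff k s * ((1 - s - of_nat k) gchoose (j - k)) * (-1) ^ (j - k) * x ^ j)" .
  qed
  also have "\<dots> = (\<Sum>j=1..K. \<Sum>k<j. em_coeff k s * ((1 - s - of_nat k) gchoose (j - k)) * (-1) ^ (j - k) * x ^ j)"
    unfolding sum.Sigma[OF finite_lessThan ballI[OF finite_atLeastAtMost]]
      sum.Sigma[OF finite_atLeastAtMost ballI[OF finite_lessThan]]
    by (rule sum.reindex_bij_witness[of _ "\<lambda>(a,b). (b,a)" "\<lambda>(a,b). (b,a)"]) auto
  also have "\<dots> = (\<Sum>j=1..K. if j = 1 then x else 0)"
  proof (intro sum.cong refl)
    fix j assume j: "j \<in> {1..K}"
    then obtain j' where j': "j = Suc j'" by (cases j) auto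
    have "(\<Sum>k<j. em_coeff k s * ((1 - s - of_nat k) gchoose (j - k)) * (-1) ^ (j - k) * x ^ j) =
       ((1 - s) gchoose j) / (s - 1) * x ^ j *
         (\<Sum>k\<le>j'. of_nat (Suc j' choose k) * (-1) ^ (Suc j' - k) * bernpoly k 1)"
      unfolding sum_distrib_left j' lessThan_Suc_atMost
    proof (intro sum.cong refl)
      fix k assume "k \<in> {..j'}"
      hence "((1 - s) gchoose Suc j') * of_nat (Suc j' choose k) =
          ((1 - s) gchoose k) * ((1 - s - of_nat k) gchoose (Suc j' - k))"
        using gbinomial_trinomial_revision[of k "Suc j'" "1 - s"] by (simp add: binomial_gbinomial)
      thus "em_coeff k s * ((1 - s - of_nat k) gchoose (Suc j' - k)) * (-1) ^ (Suc j' - k) * x ^ Suc j' =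
        ((1 - s) gchoose Suc j') / (s - 1) * x ^ Suc j' *
          (of_nat (Suc j' choose k) * (-1) ^ (Suc j' - k) * bernpoly k 1)"
        unfolding em_coeff_def
        by (simp add: divide_simps del: of_nat_Suc binomial_Suc_Suc power_Suc)
    qed
    also have "\<dots> = (if j = 1 then x else 0)"
      unfolding bernpoly_one_recurrence using assms by (simp add: j' divide_simps) (simp add: algebra_simps)
    finally show "(\<Sum>k<j. em_coeff k s * ((1 - s - of_nat k) gchoose (j - k)) * (-1) ^ (j - k) * x ^ j) =
      (if j = 1 then x else 0)" .
  qed
  also have "\<dots> = x" using assms by (simp add: sum.delta)
  finally show ?thesis .
qed

section \<open>Remainders of the binomial series, uniformly in the exponent\<close>

lemma pochhammer_nonneg_real: "(M::real) \<ge> 0 \<Longrightarrow> pochhammer M n \<ge> 0"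
  unfolding pochhammer_prod by (intro prod_nonneg) auto

lemma norm_of_nat_powr: "n > 0 \<Longrightarrow> norm (of_nat n powr s :: complex) = real n powr Re s"
  by (subst norm_powr_real_powr) auto

definition gbinomial_tail :: "nat \<Rightarrow> complex \<Rightarrow> complex \<Rightarrow> complex" where
  "gbinomial_tail J w x = (1 - x) powr w - (\<Sum>i<J. (w gchoose i) * (-x) ^ i)"

text \<open>The bound is the coefficient of x^i in (1 - x)^(-M), so one real binomial series
  majorises those of all exponents of norm at most M.\<close>

lemma norm_gbinomial_le:
  fixes w :: complex
  assumes "norm w \<le> M"
  shows "norm (w gchoose i) \<le> pochhammer M i / fact i"
proof -
  have "norm (\<Prod>t=0..<i. w - of_nat t) \<le> (\<Prod>t=0..<i. M + real t)"
    unfolding prod_norm[symmetric]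
  proof (rule prod_mono, safe)
    fix t
    have "norm (w - of_nat t) \<le> norm w + norm (of_nat t :: complex)" by (rule norm_triangle_ineq4)
    also have "norm (of_nat t :: complex) = real t" by simp
    finally show "norm (w - of_nat t) \<le> M + real t" using assms by simp
  qed auto
  thus ?thesis
    unfolding gbinomial_prod_rev pochhammer_prod norm_divide by (simp add: divide_right_mono)
qed

text \<open>The constant must not depend on w, because w will vary with s in locally uniform
  estimates. The majorant series for (1 - x)^(-M) converges at x = 1/2, which covers x = 1/n for n
  \<ge> 2; pulling out x^J costs the factor 2^J.\<close>

lemma gbinomial_tail_bound:
  "\<exists>C\<ge>0. \<forall>w x. norm w \<le> M \<longrightarrow> 0 \<le> x \<longrightarrow> x \<le> 1 / 2 \<longrightarrow>
      norm (gbinomial_tail J w (of_real x)) \<le> C * x ^ J"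
proof -
  define b where "b = (\<lambda>i. pochhammer M i / fact i * (1 / 2) ^ i)"
  have "(\<lambda>i. ((-M) gchoose i) * (- 1 / 2) ^ i) sums (1 + (- 1 / 2)) powr (-M)"
    by (rule gen_binomial_real) auto
  moreover have "((-M) gchoose i) * (- 1 / 2) ^ i = b i" for i
  proof -
    have "(-1/2::real) ^ i = (-1) ^ i * (1/2) ^ i" by (simp flip: power_mult_distrib)
    moreover have "(-1) ^ i * ((-1) ^ i * z) = z" for z :: real
      by (simp flip: mult.assoc power_mult_distrib)
    ultimately show ?thesis by (simp add: b_def gbinomial_pochhammer mult_ac)
  qed
  ultimately have b: "summable b" by (simp add: sums_iff)
  hence bJ: "summable (\<lambda>i. b (i + J))" by (simp add: summable_iff_shift)
  \<comment> \<open>For M < 0 the terms \<open>b i\<close> may be negative while the estimate is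
    vacuous; the maximum makes C non-negative in every case.\<close>
  define C where "C = max 0 (2 ^ J * (\<Sum>i. b (i + J)))"
  show ?thesis
  proof (intro exI[of _ C] conjI allI impI)
    show "C \<ge> 0" by (simp add: C_def)
    fix w :: complex and x :: real
    assume w: "norm w \<le> M" and x: "0 \<le> x" "x \<le> 1 / 2"
    define f where "f = (\<lambda>i. (w gchoose i) * (- of_real x) ^ i)"
    have "f sums (1 + (- of_real x)) powr w"
      unfolding f_def by (rule gen_binomial_complex) (use x in auto)
    hence "(\<lambda>i. f (i + J)) sums (gbinomial_tail J w (of_real x))"
      unfolding gbinomial_tail_def f_def by (subst sums_iff_shift) simp
    hence eq: "gbinomial_tail J w (of_real x) = (\<Sum>i. f (i + J))" by (simp add: sums_iff)
    have le: "norm (f (i + J)) \<le> 2 ^ J * x ^ J * b (i + J)" for i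
    proof -
      have "x ^ (i + J) \<le> x ^ J * (1 / 2) ^ i"
        using x by (simp add: power_add mult.commute[of _ "x ^ J"] mult_left_mono power_mono)
      have "norm (f (i + J)) = norm (w gchoose (i + J)) * x ^ (i + J)"
        using x by (simp add: f_def norm_mult norm_power)
      also have "\<dots> \<le> pochhammer M (i + J) / fact (i + J) * (x ^ J * (1 / 2) ^ i)"
        using x w order_trans[OF norm_ge_zero w] \<open>x ^ (i + J) \<le> _\<close>
        by (intro mult_mono norm_gbinomial_le divide_nonneg_nonneg pochhammer_nonneg_real) auto
      also have "\<dots> = 2 ^ J * x ^ J * b (i + J)"
        by (simp add: b_def power_add power_one_over)
      finally show ?thesis .
    qed
    have "norm (\<Sum>i. f (i + J)) \<le> (\<Sum>i. 2 ^ J * x ^ J * b (i + J))"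
      by (rule norm_suminf_le[OF le]) (intro summable_mult bJ)
    also have "\<dots> = (2 ^ J * (\<Sum>i. b (i + J))) * x ^ J"
      using bJ by (simp add: suminf_mult)
    also have "\<dots> \<le> C * x ^ J"
      using x by (intro mult_right_mono) (auto simp: C_def)
    finally show "norm (gbinomial_tail J w (of_real x)) \<le> C * x ^ J" unfolding eq .
  qed
qed

text \<open>
  The summand minus the increment of the truncated expansion: the difference telescopes, so
  summing \<open>em_term K s\<close> over \<open>n > N\<close> yields the remainder of the expansion.
\<close>
definition em_term :: "nat \<Rightarrow> complex \<Rightarrow> nat \<Rightarrow> complex" where
  "em_term K s n = of_nat n powr (- s) - (\<Sum>k<K. em_coeff k s *
     (of_nat (n - 1) powr (1 - s - of_nat k) - of_nat n powr (1 - s - of_nat k)))"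

text \<open>Write (n - 1)^w = n^w (1 - 1/n)^w and split (1 - 1/n)^w - 1 into a Taylor polynomial and
  a tail. By \<open>em_coeff_sum\<close> the polynomials together cancel n^(-s), so only the tails
  remain.\<close>

lemma em_term_eq:
  assumes "s \<noteq> 1" "K \<ge> 1" "n \<ge> 2"
  shows "em_term K s n = - (of_nat n powr (1 - s) *
    (\<Sum>k<K. em_coeff k s * (1 / of_nat n) ^ k *
       gbinomial_tail (Suc (K - k)) (1 - s - of_nat k) (1 / of_nat n)))"
proof -
  define x :: complex where "x = 1 / of_nat n"
  define N :: complex where "N = of_nat n powr (1 - s)"
  have n0: "(of_nat n :: complex) \<noteq> 0" using assms by auto
  have 1: "of_nat n powr (- s) = N * x"
    using n0 by (simp add: N_def x_def powr_diff powr_minus divide_simps)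
  have 2: "of_nat n powr (1 - s - of_nat k) = N * x ^ k" for k
    using n0 by (simp add: N_def x_def powr_diff powr_nat' power_one_over divide_simps)
  have 3: "of_nat (n - 1) powr w = of_nat n powr w * (1 - x) powr w" for w
  proof -
    have "(of_nat (n - 1) :: complex) = of_real (real n) * of_real (1 - 1 / real n)"
      using assms by (simp add: x_def field_simps of_nat_diff)
    also have "\<dots> powr w = of_real (real n) powr w * of_real (1 - 1 / real n) powr w"
      using assms by (intro powr_times_real) auto
    finally show ?thesis by (simp add: x_def)
  qed
  have 4: "gbinomial_tail (Suc (K - k)) w x + (\<Sum>i=1..K-k. (w gchoose i) * (-x) ^ i) = (1 - x) powr w - 1"
    for k w
    unfolding gbinomial_tail_def One_nat_def sum.atLeast1_atMost_eq sum.lessThan_Suc_shift by simp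
  have 5: "e * (N * y * (a + b)) = N * (e * y * a) + N * (e * y * b)" for e y a b
    by (simp add: algebra_simps)
  have "em_term K s n = N * x - (\<Sum>k<K. em_coeff k s * (N * x ^ k * ((1 - x) powr (1 - s - of_nat k) - 1)))"
    unfolding em_term_def 1 3 2 by (simp add: algebra_simps)
  also have "(\<Sum>k<K. em_coeff k s * (N * x ^ k * ((1 - x) powr (1 - s - of_nat k) - 1))) =
     (\<Sum>k<K. N * (em_coeff k s * x ^ k * gbinomial_tail (Suc (K - k)) (1 - s - of_nat k) x) +
       N * (em_coeff k s * x ^ k * (\<Sum>i=1..K-k. ((1 - s - of_nat k) gchoose i) * (-x) ^ i)))"
    by (simp only: 5[symmetric] 4)
  also have "\<dots> = N * (\<Sum>k<K. em_coeff k s * x ^ k * gbinomial_tail (Suc (K - k)) (1 - s - of_nat k) x) + N * x"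
    unfolding sum.distrib sum_distrib_left[symmetric] em_coeff_sum[OF assms(1,2)] by simp
  finally show ?thesis by (simp add: N_def x_def)
qed

lemma em_term_0: "em_term 0 s n = of_nat n powr (- s)"
  by (simp add: em_term_def)

lemma neg_of_nat_neq_1: "- of_nat m \<noteq> (1 :: complex)"
  by (simp add: complex_eq_iff)

text \<open>For k \<le> m + 1 the exponent is the natural number p = m + 1 - k, and a Taylor
  polynomial of degree K - k \<ge> p is already the whole binomial expansion, so the tail is zero.
  For larger k the coefficient is zero.\<close>

lemma em_term_neg_nat_eq_0:
  assumes "K \<ge> m + 2" "n \<ge> 2"
  shows "em_term K (- of_nat m) n = 0"
proof -
  note s = neg_of_nat_neq_1[of m]
  have n: "1 - 1 / of_nat n \<noteq> (0::complex)" using assms by auto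
  have "em_coeff k (- of_nat m) * (1 / of_nat n) ^ k *
      gbinomial_tail (Suc (K - k)) (1 - (- of_nat m) - of_nat k) (1 / of_nat n) = 0" if "k < K" for k
  proof (cases "k \<le> m + 1")
    case True
    define p where "p = m + 1 - k"
    have p: "(1 - (- of_nat m) - of_nat k :: complex) = of_nat p"
      using True by (simp add: p_def of_nat_diff)
    have "(\<Sum>i<Suc (K - k). (of_nat p gchoose i) * (- (1 / of_nat n)) ^ i) =
        (\<Sum>i\<le>p. of_nat (p choose i) * (- (1 / of_nat n)) ^ i :: complex)"
      unfolding binomial_gbinomial[symmetric]
      by (rule sum.mono_neutral_right) (use assms in \<open>auto simp: p_def\<close>)
    also have "\<dots> = (1 - 1 / of_nat n) ^ p"
      using binomial_ring[of "- (1 / of_nat n) :: complex" 1 p] by simp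
    finally show ?thesis
      using n unfolding p gbinomial_tail_def by (simp add: powr_nat')
  next
    case False
    thus ?thesis by (simp add: em_coeff_neg_nat)
  qed
  hence "(\<Sum>k<K. em_coeff k (- of_nat m) * (1 / of_nat n) ^ k *
      gbinomial_tail (Suc (K - k)) (1 - (- of_nat m) - of_nat k) (1 / of_nat n)) = 0"
    by (intro sum.neutral) auto
  thus ?thesis using assms by (subst em_term_eq[OF s]) auto
qed

text \<open>Each summand in \<open>em_term_eq\<close> has size x^k x^(K-k+1) = x^(K+1) with x = 1/n;
  the prefactor n^(1-s) then leaves n^(-s-K). Every unit of K thus gains one power of n.\<close>

lemma em_term_bound:
  assumes "s0 \<noteq> 1"
  shows "\<exists>C\<ge>0. \<forall>\<^sub>F s in nhds s0. \<forall>n\<ge>2. norm (em_term K s n) \<le> C * real n powr (- Re s - real K)"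
proof (cases "K = 0")
  case True
  thus ?thesis
    by (intro exI[of _ 1]) (auto simp: em_term_0 norm_of_nat_powr)
next
  case False
  hence K: "K \<ge> 1" by simp
  \<comment> \<open>M bounds the norm of 1 - s - k for all k < K and all s with norm below norm s0 +
    1.\<close>
  define M where "M = norm s0 + 2 + real K"
  define D where "D = (\<lambda>k. norm (em_coeff k s0) + 1)"
  have "\<exists>C\<ge>0. \<forall>w x. norm w \<le> M \<longrightarrow> 0 \<le> x \<longrightarrow> x \<le> 1 / 2 \<longrightarrow>
      norm (gbinomial_tail (Suc (K - k)) w (of_real x)) \<le> C * x ^ Suc (K - k)" for k
    by (rule gbinomial_tail_bound)
  then obtain C where C: "\<And>k. C k \<ge> 0" "\<And>k w x. norm w \<le> M \<Longrightarrow> 0 \<le> x \<Longrightarrow> x \<le> 1 / 2 \<Longrightarrow>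
      norm (gbinomial_tail (Suc (K - k)) w (of_real x)) \<le> C k * x ^ Suc (K - k)"
    by metis
  have "\<forall>\<^sub>F s in nhds s0. norm s < norm s0 + 1"
    by (rule order_tendstoD(2)[OF tendsto_norm[OF filterlim_ident]]) simp
  moreover have "\<forall>\<^sub>F s in nhds s0. s \<noteq> 1"
    using assms t1_space_nhds by blast
  moreover have "\<forall>\<^sub>F s in nhds s0. \<forall>k\<in>{..<K}. norm (em_coeff k s) < D k"
  proof (intro eventually_ball_finite ballI finite_lessThan)
    fix k
    have "(\<lambda>s. em_coeff k s) holomorphic_on - {1}"
      by (intro holomorphic_intros) auto
    hence "isCont (em_coeff k) s0"
      using assms by (metis Compl_iff holomorphic_on_imp_continuous_on continuous_on_eq_continuous_at
          open_Compl closed_singleton singletonD)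
    hence "((\<lambda>s. norm (em_coeff k s)) \<longlongrightarrow> norm (em_coeff k s0)) (nhds s0)"
      by (intro tendsto_norm) (simp add: isCont_def tendsto_nhds_iff)
    thus "\<forall>\<^sub>F s in nhds s0. norm (em_coeff k s) < D k"
      by (rule order_tendstoD) (simp add: D_def)
  qed
  ultimately have "\<forall>\<^sub>F s in nhds s0. \<forall>n\<ge>2. norm (em_term K s n) \<le> (\<Sum>k<K. D k * C k) * real n powr (- Re s - real K)"
  proof eventually_elim
    case (elim s)
    show ?case
    proof (intro allI impI)
      fix n :: nat assume n: "n \<ge> 2"
      define x where "x = 1 / real n"
      have x: "0 \<le> x" "x \<le> 1 / 2" using n by (auto simp: x_def field_simps)
      have "norm (\<Sum>k<K. em_coeff k s * (of_real x) ^ k *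
           gbinomial_tail (Suc (K - k)) (1 - s - of_nat k) (of_real x)) \<le> (\<Sum>k<K. D k * C k * x ^ Suc K)"
      proof (rule sum_norm_le)
        fix k assume k: "k \<in> {..<K}"
        have "norm (1 - s - of_nat k) \<le> norm (1::complex) + norm s + norm (of_nat k :: complex)"
          by (metis (no_types, opaque_lifting) add_mono norm_triangle_ineq4 order_trans order_refl)
        also have "\<dots> \<le> M" using elim k by (simp add: M_def)
        finally have w: "norm (1 - s - of_nat k) \<le> M" .
        have "norm (em_coeff k s * (of_real x) ^ k *
           gbinomial_tail (Suc (K - k)) (1 - s - of_nat k) (of_real x)) \<le> D k * x ^ k * (C k * x ^ Suc (K - k))"
          unfolding norm_mult norm_power norm_of_real
          using elim k x by (intro mult_mono C w) (auto simp: D_def less_imp_le)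
        also have "\<dots> = D k * C k * (x ^ k * x ^ Suc (K - k))" by (simp add: mult_ac)
        also have "x ^ k * x ^ Suc (K - k) = x ^ Suc K"
          using k by (subst power_add [symmetric]) simp
        finally show "norm (em_coeff k s * (of_real x) ^ k *
           gbinomial_tail (Suc (K - k)) (1 - s - of_nat k) (of_real x)) \<le> D k * C k * x ^ Suc K" .
      qed
      hence "norm (em_term K s n) \<le> real n powr (1 - Re s) * (\<Sum>k<K. D k * C k * x ^ Suc K)"
        using n elim K by (subst em_term_eq) (auto simp: norm_mult norm_of_nat_powr x_def intro!: mult_left_mono)
      also have "\<dots> = (\<Sum>k<K. D k * C k) * (real n powr (1 - Re s) * x ^ Suc K)"
        by (simp add: sum_distrib_right sum_distrib_left mult_ac)
      also have "x ^ Suc K = real n powr (- real (Suc K))"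
        unfolding x_def using n by (simp only: powr_minus powr_realpow) (simp add: powr_realpow power_one_over inverse_eq_divide flip: powr_realpow)
      also have "real n powr (1 - Re s) * real n powr (- real (Suc K)) = real n powr (- Re s - real K)"
        by (subst powr_add [symmetric]) (simp add: algebra_simps)
      finally show "norm (em_term K s n) \<le> (\<Sum>k<K. D k * C k) * real n powr (- Re s - real K)" .
    qed
  qed
  moreover have "(\<Sum>k<K. D k * C k) \<ge> 0"
    using C(1) by (intro sum_nonneg mult_nonneg_nonneg) (auto simp: D_def)
  ultimately show ?thesis by blast
qed

subsection \<open>Tails of series\<close>

text \<open>By the mean value theorem the right side is z^(-\<tau>) for some z between n and n + 1.
  Summing these increments gives the bound of the integral test.\<close>

lemma powr_tail_telescope:
  assumes "\<tau> > 1" "n \<ge> 1"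
  shows "real (Suc n) powr (-\<tau>) \<le> (real n powr (1 - \<tau>) - real (Suc n) powr (1 - \<tau>)) / (\<tau> - 1)"
proof -
  have "\<exists>z::real. real n < z \<and> z < real (Suc n) \<and>
      real (Suc n) powr (1 - \<tau>) - real n powr (1 - \<tau>) = (real (Suc n) - real n) * ((1 - \<tau>) * z powr (1 - \<tau> - 1))"
    using assms by (intro MVT2) (auto intro!: derivative_eq_intros has_real_derivative_powr)
  then obtain z where z: "real n < z" "z < real (Suc n)"
    "real (Suc n) powr (1 - \<tau>) - real n powr (1 - \<tau>) = (1 - \<tau>) * z powr (-\<tau>)"
    by auto
  have "real (Suc n) powr (-\<tau>) \<le> z powr (-\<tau>)"
    using z assms by (intro powr_mono2') auto
  moreover have "(real n powr (1 - \<tau>) - real (Suc n) powr (1 - \<tau>)) / (\<tau> - 1) = z powr (-\<tau>)"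
    using z(3) assms by (simp add: field_simps)
  ultimately show ?thesis by simp
qed

lemma bij_betw_greaterThan: "bij_betw (\<lambda>i. Suc (N + i)) UNIV {N<..}"
  by (rule bij_betwI[of _ _ _ "\<lambda>n. n - Suc N"]) auto

lemma powr_tail:
  assumes "\<tau> > 1" "N \<ge> 1"
  shows "(\<lambda>n. real n powr (-\<tau>)) summable_on {N<..}"
    and "infsum (\<lambda>n. real n powr (-\<tau>)) {N<..} \<le> real N powr (1 - \<tau>) / (\<tau> - 1)"
proof -
  define g where "g = (\<lambda>i. real (N + i) powr (1 - \<tau>) / (\<tau> - 1))"
  define f where "f = (\<lambda>i. real (Suc (N + i)) powr (-\<tau>))"
  have "(\<lambda>x. real x powr (1 - \<tau>) / (\<tau> - 1)) \<longlonglongrightarrow> 0"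
    using assms by (intro tendsto_divide_zero tendsto_neg_powr filterlim_real_sequentially) auto
  hence "g \<longlonglongrightarrow> 0"
    unfolding g_def by (subst add.commute) (rule LIMSEQ_ignore_initial_segment)
  hence g: "(\<lambda>i. g i - g (Suc i)) sums g 0"
    using telescope_sums'[of g 0] by simp
  have le: "f i \<le> g i - g (Suc i)" for i
    using powr_tail_telescope[OF assms(1), of "N + i"] assms(2)
    by (simp add: f_def g_def diff_divide_distrib add_ac)
  have f: "summable f"
    by (rule summable_comparison_test'[OF sums_summable[OF g], of 0]) (use le in \<open>auto simp: f_def\<close>)
  hence fs: "(f has_sum suminf f) UNIV"
    by (intro sums_nonneg_imp_has_sum summable_sums) (auto simp: f_def)
  hence hs: "((\<lambda>n. real n powr (-\<tau>)) has_sum suminf f) {N<..}"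
    using has_sum_reindex_bij_betw[OF bij_betw_greaterThan, of "\<lambda>n. real n powr (-\<tau>)" N "suminf f"]
    unfolding f_def by blast
  thus "(\<lambda>n. real n powr (-\<tau>)) summable_on {N<..}" by (rule has_sum_imp_summable)
  have "suminf f \<le> g 0"
    using suminf_le[OF le f sums_summable[OF g]] g by (simp add: sums_iff)
  thus "infsum (\<lambda>n. real n powr (-\<tau>)) {N<..} \<le> real N powr (1 - \<tau>) / (\<tau> - 1)"
    using infsumI[OF hs] by (simp add: g_def)
qed

lemma tail_infsum:
  fixes f :: "nat \<Rightarrow> complex"
  assumes "\<tau> > 1" "N \<ge> 1" "\<And>n. n > N \<Longrightarrow> norm (f n) \<le> C * real n powr (-\<tau>)"
  shows "(\<lambda>n. norm (f n)) summable_on {N<..}" "f summable_on {N<..}"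
    and "norm (infsum f {N<..}) \<le> C * real N powr (1 - \<tau>) / (\<tau> - 1)"
proof -
  have C: "C \<ge> 0"
  proof -
    have "0 \<le> C * real (Suc N) powr (-\<tau>)" using assms(3)[of "Suc N"] norm_ge_zero order_trans by blast
    thus ?thesis by (simp add: zero_le_mult_iff not_le)
  qed
  note s = powr_tail[OF assms(1,2)]
  have s': "(\<lambda>n. C * real n powr (-\<tau>)) summable_on {N<..}" by (intro summable_on_cmult_right s)
  show 1: "(\<lambda>n. norm (f n)) summable_on {N<..}"
    by (rule summable_on_comparison_test[OF s']) (use assms(3) in auto)
  thus "f summable_on {N<..}" by (rule abs_summable_summable)
  have "norm (infsum f {N<..}) \<le> infsum (\<lambda>n. norm (f n)) {N<..}"
    by (rule norm_infsum_bound[OF 1])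
  also have "\<dots> \<le> infsum (\<lambda>n. C * real n powr (-\<tau>)) {N<..}"
    by (rule infsum_mono[OF 1 s']) (use assms(3) in auto)
  also have "\<dots> = C * infsum (\<lambda>n. real n powr (-\<tau>)) {N<..}" by (simp add: infsum_cmult_right')
  also have "\<dots> \<le> C * (real N powr (1 - \<tau>) / (\<tau> - 1))" by (intro mult_left_mono s C)
  finally show "norm (infsum f {N<..}) \<le> C * real N powr (1 - \<tau>) / (\<tau> - 1)" by simp
qed

text \<open>Summability is assumed because \<open>has_sum\<close> means unconditional convergence,
  which convergence of the telescoping partial sums does not supply.\<close>

lemma has_sum_telescope:
  fixes f :: "nat \<Rightarrow> complex"
  assumes "(\<lambda>n. f (n - 1) - f n) summable_on {N<..}" "f \<longlonglongrightarrow> 0"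
  shows "((\<lambda>n. f (n - 1) - f n) has_sum f N) {N<..}"
proof -
  define S where "S = infsum (\<lambda>n. f (n - 1) - f n) {N<..}"
  have hs: "((\<lambda>n. f (n - 1) - f n) has_sum S) {N<..}" unfolding S_def by (rule has_sum_infsum) fact
  hence "((\<lambda>i. f (N + i) - f (N + Suc i)) has_sum S) UNIV"
    using has_sum_reindex_bij_betw[OF bij_betw_greaterThan, of "\<lambda>n. f (n - 1) - f n" N S] by simp
  hence "(\<lambda>i. f (N + i) - f (N + Suc i)) sums S" by (rule has_sum_imp_sums)
  moreover have "(\<lambda>i. f (N + i)) \<longlonglongrightarrow> 0"
    by (subst add.commute) (rule LIMSEQ_ignore_initial_segment, fact)
  from telescope_sums'[OF this] have "(\<lambda>i. f (N + i) - f (N + Suc i)) sums f N" by simp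
  ultimately have "S = f N" by (rule sums_unique2)
  thus ?thesis using hs by simp
qed

subsection \<open>Locally dominated series\<close>

text \<open>The domain is a general Hausdorff space so that joint continuity in three variables is
  covered. The majorant in the Weierstrass test is only local, as the bounds below depend on the
  point.\<close>

lemma continuous_on_infsum:
  fixes f :: "'i \<Rightarrow> 'a::t2_space \<Rightarrow> 'b::banach"
  assumes "open U" "\<And>n. n \<in> A \<Longrightarrow> continuous_on U (f n)"
    and "\<And>p. p \<in> U \<Longrightarrow> \<exists>M. M summable_on A \<and> (\<forall>\<^sub>F q in nhds p. \<forall>n\<in>A. norm (f n q) \<le> M n)"
  shows "continuous_on U (\<lambda>q. \<Sum>\<^sub>\<infinity>n\<in>A. f n q)"
proof (rule continuous_at_imp_continuous_on, rule ballI)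
  fix p assume p: "p \<in> U"
  then obtain M where M: "M summable_on A" "\<forall>\<^sub>F q in nhds p. \<forall>n\<in>A. norm (f n q) \<le> M n"
    using assms(3) by blast
  then obtain W where W: "open W" "p \<in> W" "\<And>q n. q \<in> W \<Longrightarrow> n \<in> A \<Longrightarrow> norm (f n q) \<le> M n"
    unfolding eventually_nhds by blast
  have "uniform_limit (W \<inter> U) (\<lambda>X y. \<Sum>n\<in>X. f n y) (\<lambda>y. \<Sum>\<^sub>\<infinity>n\<in>A. f n y) (finite_subsets_at_top A)"
    by (rule Weierstrass_m_test_general[OF _ M(1)]) (use W in auto)
  hence "continuous_on (W \<inter> U) (\<lambda>q. \<Sum>\<^sub>\<infinity>n\<in>A. f n q)"
  proof (rule uniform_limit_theorem[rotated])
    show "\<forall>\<^sub>F X in finite_subsets_at_top A. continuous_on (W \<inter> U) (\<lambda>y. \<Sum>n\<in>X. f n y)"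
      using assms(2) by (intro eventually_finite_subsets_at_top_weakI continuous_on_sum)
        (meson continuous_on_subset inf_le2 subsetD)
  qed simp
  thus "isCont (\<lambda>q. \<Sum>\<^sub>\<infinity>n\<in>A. f n q) p"
    by (rule continuous_on_interior) (use p W assms(1) in \<open>simp add: interior_open open_Int\<close>)
qed

lemma holomorphic_infsum:
  fixes f :: "'i \<Rightarrow> complex \<Rightarrow> complex"
  assumes "open U" "\<And>n. n \<in> A \<Longrightarrow> f n holomorphic_on U"
    and "\<And>p. p \<in> U \<Longrightarrow> \<exists>M. M summable_on A \<and> (\<forall>\<^sub>F q in nhds p. \<forall>n\<in>A. norm (f n q) \<le> M n)"
  shows "(\<lambda>q. \<Sum>\<^sub>\<infinity>n\<in>A. f n q) holomorphic_on U"
proof -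
  have "\<exists>T. open T \<and> p \<in> T \<and> (\<lambda>q. \<Sum>\<^sub>\<infinity>n\<in>A. f n q) holomorphic_on T" if p: "p \<in> U" for p
  proof -
    obtain M where M: "M summable_on A" "\<forall>\<^sub>F q in nhds p. \<forall>n\<in>A. norm (f n q) \<le> M n"
      using assms(3) p by blast
    then obtain W where W: "open W" "p \<in> W" "\<And>q n. q \<in> W \<Longrightarrow> n \<in> A \<Longrightarrow> norm (f n q) \<le> M n"
      unfolding eventually_nhds by blast
    obtain r where r: "r > 0" "cball p r \<subseteq> W \<inter> U"
      using open_contains_cball_eq[of "W \<inter> U"] W p assms(1) by (metis IntI open_Int)
    have "uniform_limit (cball p r) (\<lambda>X y. \<Sum>n\<in>X. f n y) (\<lambda>y. \<Sum>\<^sub>\<infinity>n\<in>A. f n y) (finite_subsets_at_top A)"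
      by (rule Weierstrass_m_test_general[OF _ M(1)]) (use W r in auto)
    moreover have "(\<lambda>y. \<Sum>n\<in>X. f n y) holomorphic_on (cball p r)" if "X \<subseteq> A" for X
      using assms(2) that r by (intro holomorphic_on_sum) (meson holomorphic_on_subset inf.boundedE subsetD)
    hence "\<forall>\<^sub>F X in finite_subsets_at_top A. continuous_on (cball p r) (\<lambda>y. \<Sum>n\<in>X. f n y) \<and>
        (\<lambda>y. \<Sum>n\<in>X. f n y) holomorphic_on (ball p r)"
      by (intro eventually_finite_subsets_at_top_weakI conjI holomorphic_on_imp_continuous_on)
         (auto intro: holomorphic_on_subset[OF _ ball_subset_cball])
    ultimately have "(\<lambda>q. \<Sum>\<^sub>\<infinity>n\<in>A. f n q) holomorphic_on ball p r"
      using holomorphic_uniform_limit by (metis finite_subsets_at_top_neq_bot)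
    thus ?thesis using r by (intro exI[of _ "ball p r"]) auto
  qed
  thus ?thesis
    unfolding holomorphic_on_def[of _ U]
    by (blast intro: field_differentiable_at_within dest: holomorphic_on_imp_differentiable_at)
qed

subsection \<open>The Euler--Maclaurin remainder\<close>

text \<open>For K = 0 this is the tail of the Dirichlet series itself, so the same function serves
  as the tail to be expanded and as the remainder of the expansion.\<close>

definition em_rest :: "nat \<Rightarrow> complex \<Rightarrow> nat \<Rightarrow> complex" where
  "em_rest K s N = (\<Sum>\<^sub>\<infinity>n\<in>{N<..}. em_term K s n)"

lemma of_nat_nonpos_Reals [simp]: "n > 0 \<Longrightarrow> (of_nat n :: complex) \<notin> \<real>\<^sub>\<le>\<^sub>0"
  by (auto simp: complex_nonpos_Reals_iff)

lemma holomorphic_em_term: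
  assumes "n \<ge> 2"
  shows "(\<lambda>s. em_term K s n) holomorphic_on - {1}"
  unfolding em_term_def using assms
  by (intro holomorphic_intros) auto

lemma em_term_summable:
  assumes "s \<noteq> 1" "Re s > 1 - real K" "N \<ge> 1"
  shows "em_term K s summable_on {N<..}"
proof -
  obtain C where "C \<ge> 0" "\<forall>\<^sub>F s in nhds s. \<forall>n\<ge>2. norm (em_term K s n) \<le> C * real n powr (- Re s - real K)"
    using em_term_bound[OF assms(1)] by blast
  hence "norm (em_term K s n) \<le> C * real n powr (- (Re s + K))" if "n \<ge> 2" for n
    using that by (auto dest!: eventually_nhds_x_imp_x)
  thus ?thesis
    by (intro tail_infsum[of "Re s + K" N _ C]) (use assms in auto)
qed

lemma eventually_nhds_Re_greater: "c < Re s0 \<Longrightarrow> \<forall>\<^sub>F s in nhds s0. c < Re s"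
  by (rule order_tendstoD(1)[OF tendsto_Re[OF filterlim_ident]])

lemma em_rest_bound:
  assumes "s0 \<noteq> 1" "Re s0 > 1 - real K"
  shows "\<exists>C\<ge>0. \<forall>\<^sub>F s in nhds s0. \<forall>N\<ge>1. norm (em_rest K s N) \<le> C * real N powr (1 - Re s - real K)"
proof -
  obtain C where C: "C \<ge> 0" "\<forall>\<^sub>F s in nhds s0. \<forall>n\<ge>2. norm (em_term K s n) \<le> C * real n powr (- Re s - real K)"
    using em_term_bound[OF assms(1)] by blast
  \<comment> \<open>Half the distance to the abscissa of convergence: for s near s0 the denominator
    Re s + K - 1 in the tail estimate stays above e.\<close>
  define e where "e = (Re s0 + K - 1) / 2"
  have e: "e > 0" "1 - real K + e < Re s0" using assms by (auto simp: e_def field_simps)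
  from C(2) eventually_nhds_Re_greater[OF e(2)]
  have "\<forall>\<^sub>F s in nhds s0. \<forall>N\<ge>1. norm (em_rest K s N) \<le> (C / e) * real N powr (1 - Re s - real K)"
  proof eventually_elim
    case (elim s)
    show ?case
    proof safe
      fix N :: nat assume N: "N \<ge> 1"
      have "norm (em_rest K s N) \<le> C * real N powr (1 - (Re s + K)) / (Re s + K - 1)"
        unfolding em_rest_def using elim N e by (intro tail_infsum) (auto simp: algebra_simps)
      also have "\<dots> \<le> C * real N powr (1 - (Re s + K)) / e"
        using C e elim by (intro divide_left_mono mult_pos_pos) auto
      finally show "norm (em_rest K s N) \<le> (C / e) * real N powr (1 - Re s - real K)"
        by (simp add: algebra_simps)
    qed
  qed
  thus ?thesis using C e by (intro exI[of _ "C / e"]) auto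
qed

lemma holomorphic_em_rest:
  assumes "N \<ge> 1"
  shows "(\<lambda>s. em_rest K s N) holomorphic_on {s. s \<noteq> 1 \<and> Re s > 1 - real K}"
  unfolding em_rest_def
proof (rule holomorphic_infsum)
  show "open {s. s \<noteq> 1 \<and> 1 - real K < Re s}"
    by (intro open_Collect_conj open_Collect_neq open_Collect_less continuous_intros)
  show "(\<lambda>s. em_term K s n) holomorphic_on {s. s \<noteq> 1 \<and> 1 - real K < Re s}" if "n \<in> {N<..}" for n
    by (rule holomorphic_on_subset[OF holomorphic_em_term]) (use that assms in auto)
  fix s0 assume s0: "s0 \<in> {s. s \<noteq> 1 \<and> 1 - real K < Re s}"
  then obtain C where C: "C \<ge> 0" "\<forall>\<^sub>F s in nhds s0. \<forall>n\<ge>2. norm (em_term K s n) \<le> C * real n powr (- Re s - real K)"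
    using em_term_bound[of s0] by blast
  \<comment> \<open>The midpoint between 1 and Re s0 + K: a summable exponent that still dominates
    for all s near s0.\<close>
  define \<tau> where "\<tau> = (Re s0 + K + 1) / 2"
  have t: "\<tau> > 1" "\<tau> - K < Re s0" using s0 by (auto simp: \<tau>_def field_simps)
  show "\<exists>M. M summable_on {N<..} \<and> (\<forall>\<^sub>F s in nhds s0. \<forall>n\<in>{N<..}. norm (em_term K s n) \<le> M n)"
  proof (intro exI conjI)
    show "(\<lambda>n. C * real n powr (-\<tau>)) summable_on {N<..}"
      by (intro summable_on_cmult_right powr_tail t assms)
    from C(2) eventually_nhds_Re_greater[OF t(2)]
    show "\<forall>\<^sub>F s in nhds s0. \<forall>n\<in>{N<..}. norm (em_term K s n) \<le> C * real n powr (-\<tau>)"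
    proof eventually_elim
      case (elim s)
      show ?case
      proof safe
        fix n assume n: "n > N"
        hence "norm (em_term K s n) \<le> C * real n powr (- Re s - real K)" using elim assms by auto
        also have "\<dots> \<le> C * real n powr (-\<tau>)"
          using n elim C assms by (intro mult_left_mono powr_mono) auto
        finally show "norm (em_term K s n) \<le> C * real n powr (-\<tau>)" .
      qed
    qed
  qed
qed

lemma em_rest_neg_nat_eq_0:
  assumes "K \<ge> m + 2" "N \<ge> 1"
  shows "em_rest K (- of_nat m) N = 0"
  unfolding em_rest_def using assms
  by (intro infsum_0) (auto intro!: em_term_neg_nat_eq_0)

text \<open>The difference of the terms of orders 0 and K is an increment of the truncated
  expansion, which tends to 0 for Re s > 1; telescoping gives its value at N. The right side makes
  sense for Re s > 1 - K apart from s = 1 and so provides the continuation.\<close>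

lemma em_rest_0_eq:
  assumes "Re s > 1" "N \<ge> 1"
  shows "em_rest 0 s N = (\<Sum>k<K. em_coeff k s * of_nat N powr (1 - s - of_nat k)) + em_rest K s N"
proof -
  define g where "g = (\<lambda>n. \<Sum>k<K. em_coeff k s * of_nat n powr (1 - s - of_nat k))"
  have s: "s \<noteq> 1" using assms by auto
  have eq: "g (n - 1) - g n = em_term 0 s n - em_term K s n" for n
    by (simp add: g_def em_term_def sum_subtractf right_diff_distrib)
  have sm: "em_term L s summable_on {N<..}" for L
    by (rule em_term_summable) (use assms s in auto)
  have sg: "(\<lambda>n. g (n - 1) - g n) summable_on {N<..}"
    unfolding eq using summable_on_add[OF sm[of 0] summable_on_uminus[THEN iffD2, OF sm[of K]]] by simp
  have "(\<lambda>n. of_nat n powr (1 - s - of_nat k)) \<longlonglongrightarrow> (0 :: complex)" for k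
  proof (rule tendsto_norm_zero_cancel)
    have "(\<lambda>n. real n powr (1 - Re s - k)) \<longlonglongrightarrow> 0"
      by (intro tendsto_neg_powr filterlim_real_sequentially) (use assms in auto)
    thus "(\<lambda>n. norm (of_nat n powr (1 - s - of_nat k) :: complex)) \<longlonglongrightarrow> 0"
      by (rule Lim_transform_eventually) (auto intro!: eventually_mono[OF eventually_gt_at_top[of 0]] simp: norm_of_nat_powr)
  qed
  hence "g \<longlonglongrightarrow> (\<Sum>k<K. em_coeff k s * 0)" unfolding g_def by (intro tendsto_intros)
  hence "g \<longlonglongrightarrow> 0" by simp
  from has_sum_telescope[OF sg this] have "infsum (\<lambda>n. em_term 0 s n - em_term K s n) {N<..} = g N"
    unfolding eq by (rule infsumI)
  also have "infsum (\<lambda>n. em_term 0 s n - em_term K s n) {N<..} = em_rest 0 s N - em_rest K s N"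
    unfolding em_rest_def using infsum_add[OF sm[of 0] summable_on_uminus[THEN iffD2, OF sm[of K]]]
    by (simp add: infsum_uminus)
  finally show ?thesis by (simp add: g_def algebra_simps)
qed

subsection \<open>The Riemann zeta function\<close>

text \<open>The expansion is taken at N = 1, where all powers of N are 1; the leading 1 is the term
  n = 1 of the series.\<close>

definition em_zeta :: "nat \<Rightarrow> complex \<Rightarrow> complex" where
  "em_zeta K s = 1 + (\<Sum>k<K. em_coeff k s) + em_rest K s 1"

lemma holomorphic_em_zeta: "em_zeta K holomorphic_on {s. s \<noteq> 1 \<and> Re s > 1 - real K}"
  unfolding em_zeta_def by (intro holomorphic_intros holomorphic_em_rest) auto

lemma em_zeta_series:
  assumes "Re s > 1"
  shows "em_zeta K s = (\<Sum>\<^sub>\<infinity>n\<in>{1::nat..}. of_nat n powr (- s))"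
proof -
  have s: "s \<noteq> 1" using assms by auto
  have "em_zeta K s = 1 + em_rest 0 s 1"
    using em_rest_0_eq[OF assms, of 1 K] by (simp add: em_zeta_def)
  also have "em_rest 0 s 1 = (\<Sum>\<^sub>\<infinity>n\<in>{1<..}. of_nat n powr (- s))"
    by (simp add: em_rest_def em_term_0)
  also have "1 + \<dots> = (\<Sum>\<^sub>\<infinity>n\<in>insert 1 {1<..}. of_nat n powr (- s))"
    using em_term_summable[OF s, of 0 1] assms
    by (subst infsum_insert) (auto simp: em_term_0[abs_def])
  also have "insert 1 {1<..} = {1::nat..}" by auto
  finally show ?thesis .
qed

lemma connected_halfspace_minus_1: "connected {s::complex. s \<noteq> 1 \<and> Re s > c}"
proof -
  have "connected ({s. Re s > c} - {1})"
    by (intro connected_open_delete convex_connected convex_halfspace_Re_gt open_halfspace_Re_gt) auto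
  moreover have "{s. Re s > c} - {1} = {s. s \<noteq> 1 \<and> Re s > c}" by auto
  ultimately show ?thesis by simp
qed

lemma em_zeta_unique:
  assumes "s \<noteq> 1" "Re s > 1 - real K" "Re s > 1 - real L"
  shows "em_zeta K s = em_zeta L s"
proof (rule analytic_continuation_open[where f = "em_zeta K" and g = "em_zeta L" and
    s = "{s. Re s > 1}" and s' = "{s. s \<noteq> 1 \<and> Re s > 1 - real (min K L)}"])
  show "open {s. s \<noteq> 1 \<and> 1 - real (min K L) < Re s}"
    by (intro open_Collect_conj open_Collect_neq open_Collect_less continuous_intros)
  have "(2::complex) \<in> {s. Re s > 1}" by simp
  thus "{s. Re s > 1} \<noteq> {}" by blast
qed (use assms in \<open>auto simp: open_halfspace_Re_gt em_zeta_series min_def intro: connected_halfspace_minus_1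
    intro!: holomorphic_on_subset[OF holomorphic_em_zeta]\<close>)

text \<open>The order depends on s and jumps, but it always satisfies 1 - K < Re s. Near a given
  point it may be replaced by a fixed order without changing the value, and fixed orders are
  holomorphic.\<close>

lemma holomorphic_em_zeta_glued:
  "(\<lambda>s. em_zeta (nat \<lceil>2 - Re s\<rceil>) s) holomorphic_on - {1}"
proof -
  define G where "G = (\<lambda>s. em_zeta (nat \<lceil>2 - Re s\<rceil>) s)"
  have k: "Re s > 1 - real (nat \<lceil>2 - Re s\<rceil>)" for s by linarith
  have eq: "G s = em_zeta K s" if "s \<noteq> 1" "Re s > 1 - real K" for s K
    unfolding G_def using that k by (intro em_zeta_unique) auto
  have "G field_differentiable at s" if s: "s \<in> - {1}" for s
  proof -
    define K where "K = nat \<lceil>2 - Re s\<rceil>"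
    have o: "open {s. s \<noteq> 1 \<and> 1 - real K < Re s}"
      by (intro open_Collect_conj open_Collect_neq open_Collect_less continuous_intros)
    have "G holomorphic_on {s. s \<noteq> 1 \<and> 1 - real K < Re s}"
      using holomorphic_em_zeta[of K] by (rule holomorphic_transform) (use eq in auto)
    thus ?thesis using s k[of s] o by (auto simp: K_def intro!: holomorphic_on_imp_differentiable_at)
  qed
  thus ?thesis unfolding G_def by (auto simp: holomorphic_on_def field_differentiable_at_within)
qed

lemma riemann_zeta_eq:
  assumes "s \<noteq> 1" "Re s > 1 - real K"
  shows "riemann_zeta s = em_zeta K s"
proof -
  define G where "G = (\<lambda>s. em_zeta (nat \<lceil>2 - Re s\<rceil>) s)"
  have G: "G holomorphic_on - {1}" unfolding G_def by (rule holomorphic_em_zeta_glued)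
  have Gser: "G t = (\<Sum>\<^sub>\<infinity>n\<in>{1::nat..}. of_nat n powr (- t))" if "Re t > 1" for t
    unfolding G_def by (rule em_zeta_series[OF that])
  define Q where "Q = (\<lambda>v. \<exists>U g. open U \<and> connected U \<and> {t. Re t > 1} \<subseteq> U \<and> s \<in> U \<and>
     g holomorphic_on U \<and>
     (\<forall>t. Re t > 1 \<longrightarrow> g t = (\<Sum>\<^sub>\<infinity>n\<in>{1::nat..}. of_nat n powr (- t))) \<and> v = g s)"
  have "riemann_zeta s = (THE v. Q v)" unfolding riemann_zeta_def Q_def ..
  also have "\<dots> = G s"
  proof (rule the_equality)
    have "connected (- {1 :: complex})"
      by (simp add: connected_punctured_universe)
    thus "Q (G s)" unfolding Q_def using assms G Gser
      by (intro exI[of _ "- {1}"] exI[of _ G]) auto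
    fix v assume "Q v"
    then obtain U g where U: "open U" "connected U" "{t. Re t > 1} \<subseteq> U" "s \<in> U" "g holomorphic_on U"
      "\<And>t. Re t > 1 \<Longrightarrow> g t = (\<Sum>\<^sub>\<infinity>n\<in>{1::nat..}. of_nat n powr (- t))" "v = g s"
      unfolding Q_def by blast
    have "g s = G s"
    \<comment> \<open>The competing domain U may contain 1, where G is not known to be holomorphic.
      Deleting one point from a connected open plane set keeps it connected.\<close>
    proof (rule analytic_continuation_open[where f = g and g = G and s = "{s. Re s > 1}" and s' = "U - {1}"])
      have "(2::complex) \<in> {s. Re s > 1}" by simp
      thus "{s. Re s > 1} \<noteq> {}" by blast
      show "connected (U - {1})" using U by (intro connected_open_delete) auto
    qed (use assms U Gser G in \<open>auto simp: open_halfspace_Re_gt intro: holomorphic_on_subset\<close>)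
    thus "v = G s" using U by simp
  qed
  also have "G s = em_zeta K s"
    unfolding G_def by (rule em_zeta_unique) (use assms in \<open>auto, linarith\<close>)
  finally show ?thesis .
qed

lemma holomorphic_riemann_zeta: "riemann_zeta holomorphic_on - {1}"
  using holomorphic_em_zeta_glued
proof (rule holomorphic_transform)
  fix s :: complex assume "s \<in> - {1}"
  thus "em_zeta (nat \<lceil>2 - Re s\<rceil>) s = riemann_zeta s"
    by (intro riemann_zeta_eq[symmetric]) (auto, linarith)
qed

lemma riemann_zeta_has_sum:
  assumes "Re s > 1"
  shows "((\<lambda>n. of_nat n powr (- s)) has_sum riemann_zeta s) {1::nat..}"
proof -
  have s: "s \<noteq> 1" using assms by auto
  have "(\<lambda>n. of_nat n powr (- s) :: complex) summable_on insert 1 {1<..}"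
    using em_term_summable[OF s, of 0 1] assms
    by (subst summable_on_insert_iff) (auto simp: em_term_0[abs_def])
  moreover have "insert 1 {1<..} = {1::nat..}" by auto
  moreover have "riemann_zeta s = (\<Sum>\<^sub>\<infinity>n\<in>{1::nat..}. of_nat n powr (- s))"
    using riemann_zeta_eq[OF s, of 0] em_zeta_series[OF assms, of 0] assms by auto
  ultimately show ?thesis by simp
qed

subsection \<open>Separately holomorphic functions of three variables\<close>

lemma open_slices:
  assumes "open U"
  shows "open {z. (z, b, c) \<in> U}" "open {z. (a, z, c) \<in> U}" "open {z. (a, b, z) \<in> U}"
proof -
  have "open ((\<lambda>z. (z, b, c)) -` U)" "open ((\<lambda>z. (a, z, c)) -` U)" "open ((\<lambda>z. (a, b, z)) -` U)"
    by (intro open_vimage assms continuous_intros)+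
  thus "open {z. (z, b, c) \<in> U}" "open {z. (a, z, c) \<in> U}" "open {z. (a, b, z) \<in> U}"
    by (simp_all add: vimage_def)
qed

text \<open>On open slices pointwise differentiability is holomorphy, so the closure rules for one
  variable apply to each slice.\<close>

lemma holomorphic3_on_iff:
  assumes "open U"
  shows "holomorphic3_on g U \<longleftrightarrow> continuous_on U g \<and>
    (\<forall>b c. (\<lambda>z. g (z, b, c)) holomorphic_on {z. (z, b, c) \<in> U}) \<and>
    (\<forall>a c. (\<lambda>z. g (a, z, c)) holomorphic_on {z. (a, z, c) \<in> U}) \<and>
    (\<forall>a b. (\<lambda>z. g (a, b, z)) holomorphic_on {z. (a, b, z) \<in> U})"
proof -
  have hol: "f holomorphic_on S \<longleftrightarrow> (\<forall>x\<in>S. f field_differentiable at x)" if "open S" for f S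
    using that by (simp add: holomorphic_on_open field_differentiable_def)
  have "(\<forall>(a, b, c)\<in>U. P a b c \<and> Q a b c \<and> R a b c) \<longleftrightarrow>
      (\<forall>b c. \<forall>a\<in>{z. (z, b, c) \<in> U}. P a b c) \<and> (\<forall>a c. \<forall>b\<in>{z. (a, z, c) \<in> U}. Q a b c) \<and>
      (\<forall>a b. \<forall>c\<in>{z. (a, b, z) \<in> U}. R a b c)" for P Q R
    by (simp add: split_paired_all Ball_def) blast
  thus ?thesis
    unfolding holomorphic3_on_def hol[OF open_slices(1)[OF assms]] hol[OF open_slices(2)[OF assms]]
      hol[OF open_slices(3)[OF assms]]
    by simp
qed

lemma holomorphic3_on_subset: "holomorphic3_on g U \<Longrightarrow> V \<subseteq> U \<Longrightarrow> holomorphic3_on g V"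
  unfolding holomorphic3_on_def by (auto intro: continuous_on_subset)

lemma holomorphic3_on_cong:
  assumes "open U" "\<And>p. p \<in> U \<Longrightarrow> f p = g p"
  shows "holomorphic3_on f U \<longleftrightarrow> holomorphic3_on g U"
  unfolding holomorphic3_on_iff[OF assms(1)]
  by (intro conj_cong iff_allI continuous_on_cong holomorphic_cong refl) (use assms(2) in auto)

named_theorems holomorphic3_intros

lemma holomorphic3_const [holomorphic3_intros]: "open U \<Longrightarrow> holomorphic3_on (\<lambda>p. k) U"
  by (simp add: holomorphic3_on_iff continuous_on_const)

lemma holomorphic3_proj [holomorphic3_intros]:
  assumes "open U"
  shows "holomorphic3_on (\<lambda>p. fst p) U" "holomorphic3_on (\<lambda>p. fst (snd p)) U"
    "holomorphic3_on (\<lambda>p. snd (snd p)) U"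
  using assms by (auto simp: holomorphic3_on_iff intro!: continuous_intros holomorphic_intros)

lemma holomorphic3_add [holomorphic3_intros]:
  "open U \<Longrightarrow> holomorphic3_on f U \<Longrightarrow> holomorphic3_on g U \<Longrightarrow> holomorphic3_on (\<lambda>p. f p + g p) U"
  by (simp add: holomorphic3_on_iff continuous_on_add holomorphic_on_add)

lemma holomorphic3_mult [holomorphic3_intros]:
  "open U \<Longrightarrow> holomorphic3_on f U \<Longrightarrow> holomorphic3_on g U \<Longrightarrow> holomorphic3_on (\<lambda>p. f p * g p) U"
  by (simp add: holomorphic3_on_iff continuous_on_mult holomorphic_on_mult)

lemma holomorphic3_diff [holomorphic3_intros]:
  "open U \<Longrightarrow> holomorphic3_on f U \<Longrightarrow> holomorphic3_on g U \<Longrightarrow> holomorphic3_on (\<lambda>p. f p - g p) U"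
  by (simp add: holomorphic3_on_iff continuous_on_diff holomorphic_on_diff)

lemma holomorphic3_sum [holomorphic3_intros]:
  "open U \<Longrightarrow> (\<And>k. k \<in> A \<Longrightarrow> holomorphic3_on (f k) U) \<Longrightarrow> holomorphic3_on (\<lambda>p. \<Sum>k\<in>A. f k p) U"
  by (simp add: holomorphic3_on_iff continuous_on_sum holomorphic_on_sum)

lemma holomorphic3_compose:
  assumes "open U" "h holomorphic_on S" "holomorphic3_on l U" "\<And>p. p \<in> U \<Longrightarrow> l p \<in> S"
  shows "holomorphic3_on (\<lambda>p. h (l p)) U"
proof -
  have *: "(\<lambda>z. h (l (\<phi> z))) holomorphic_on {z. \<phi> z \<in> U}"
    if "(\<lambda>z. l (\<phi> z)) holomorphic_on {z. \<phi> z \<in> U}" for \<phi> :: "complex \<Rightarrow> _"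
    using holomorphic_on_compose_gen[OF that assms(2)] assms(4) by (auto simp: o_def image_subset_iff)
  have "continuous_on U (\<lambda>p. h (l p))"
    using assms(3,4) by (intro continuous_on_compose2[OF holomorphic_on_imp_continuous_on[OF assms(2)]])
      (auto simp: holomorphic3_on_iff[OF assms(1)])
  thus ?thesis
    using assms(3) *[of "\<lambda>z. (z, b, c)" for b c] *[of "\<lambda>z. (a, z, c)" for a c] *[of "\<lambda>z. (a, b, z)" for a b]
    unfolding holomorphic3_on_iff[OF assms(1)] by blast
qed

lemma holomorphic3_infsum:
  fixes f :: "'i \<Rightarrow> complex \<times> complex \<times> complex \<Rightarrow> complex"
  assumes U: "open U" and f: "\<And>n. n \<in> A \<Longrightarrow> holomorphic3_on (f n) U"
    and M: "\<And>p. p \<in> U \<Longrightarrow> \<exists>M. M summable_on A \<and> (\<forall>\<^sub>F q in nhds p. \<forall>n\<in>A. norm (f n q) \<le> M n)"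
  shows "holomorphic3_on (\<lambda>q. \<Sum>\<^sub>\<infinity>n\<in>A. f n q) U"
proof -
  \<comment> \<open>Here \<phi> stands for any of the three embeddings of a coordinate line; the
    local majorant is pulled back along it.\<close>
  have *: "(\<lambda>z. \<Sum>\<^sub>\<infinity>n\<in>A. f n (\<phi> z)) holomorphic_on {z. \<phi> z \<in> U}"
    if o: "open {z. \<phi> z \<in> U}" and h: "\<And>n. n \<in> A \<Longrightarrow> (\<lambda>z. f n (\<phi> z)) holomorphic_on {z. \<phi> z \<in> U}"
      and \<phi>: "\<And>z. (\<phi> \<longlongrightarrow> \<phi> z) (nhds z)" for \<phi> :: "complex \<Rightarrow> complex \<times> complex \<times> complex"
  proof (rule holomorphic_infsum[OF o h])
    fix z assume "z \<in> {z. \<phi> z \<in> U}"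
    then obtain M where "M summable_on A" "\<forall>\<^sub>F q in nhds (\<phi> z). \<forall>n\<in>A. norm (f n q) \<le> M n"
      using M by blast
    thus "\<exists>M. M summable_on A \<and> (\<forall>\<^sub>F x in nhds z. \<forall>n\<in>A. norm (f n (\<phi> x)) \<le> M n)"
      using \<phi>[of z] by (auto dest: eventually_compose_filterlim)
  qed
  have 1: "((\<lambda>z. (z, b, c)) \<longlongrightarrow> (z, b, c)) (nhds z)" "((\<lambda>z. (b, z, c)) \<longlongrightarrow> (b, z, c)) (nhds z)"
    "((\<lambda>z. (b, c, z)) \<longlongrightarrow> (b, c, z)) (nhds z)" for b c z :: complex
    by (intro tendsto_Pair tendsto_const filterlim_ident)+
  note f' = f[unfolded holomorphic3_on_iff[OF U]]
  have "continuous_on U (\<lambda>q. \<Sum>\<^sub>\<infinity>n\<in>A. f n q)"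
    by (rule continuous_on_infsum[OF U _ M]) (use f' in auto)
  moreover have "(\<lambda>z. \<Sum>\<^sub>\<infinity>n\<in>A. f n (z, b, c)) holomorphic_on {z. (z, b, c) \<in> U}" for b c
    by (rule *[OF open_slices(1)[OF U] _ 1(1)]) (use f' in auto)
  moreover have "(\<lambda>z. \<Sum>\<^sub>\<infinity>n\<in>A. f n (b, z, c)) holomorphic_on {z. (b, z, c) \<in> U}" for b c
    by (rule *[OF open_slices(2)[OF U] _ 1(2)]) (use f' in auto)
  moreover have "(\<lambda>z. \<Sum>\<^sub>\<infinity>n\<in>A. f n (b, c, z)) holomorphic_on {z. (b, c, z) \<in> U}" for b c
    by (rule *[OF open_slices(3)[OF U] _ 1(3)]) (use f' in auto)
  ultimately show ?thesis unfolding holomorphic3_on_iff[OF U] by blast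
qed

section \<open>The identity theorem in three variables\<close>

lemma open_box_subset:
  fixes a b c :: complex
  assumes "open U" "(a, b, c) \<in> U"
  obtains r where "r > 0" "ball a r \<times> ball b r \<times> ball c r \<subseteq> U"
proof -
  obtain A B where AB: "open A" "open B" "a \<in> A" "(b, c) \<in> B" "A \<times> B \<subseteq> U"
    using open_prod_elim[OF assms] by (metis mem_Sigma_iff)
  obtain C D where CD: "open C" "open D" "b \<in> C" "c \<in> D" "C \<times> D \<subseteq> B"
    using open_prod_elim[OF AB(2,4)] by (metis mem_Sigma_iff)
  obtain r1 r2 r3 where r: "r1 > 0" "ball a r1 \<subseteq> A" "r2 > 0" "ball b r2 \<subseteq> C" "r3 > 0" "ball c r3 \<subseteq> D"
    using AB CD by (metis open_contains_ball_eq)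
  have "ball a (min r1 (min r2 r3)) \<times> ball b (min r1 (min r2 r3)) \<times> ball c (min r1 (min r2 r3))
      \<subseteq> ball a r1 \<times> ball b r2 \<times> ball c r3"
    by (intro Sigma_mono subset_ball) auto
  also have "\<dots> \<subseteq> A \<times> (C \<times> D)" using r by (intro Sigma_mono) auto
  also have "\<dots> \<subseteq> U" using AB CD by blast
  finally show ?thesis using r by (intro that[of "min r1 (min r2 r3)"]) auto
qed

text \<open>In a product of domains the one-variable identity theorem can be applied to one
  coordinate after another, each time enlarging one factor of the set of agreement from
  \<open>E1\<close>, \<open>E2\<close>, \<open>E3\<close> to \<open>D1\<close>, \<open>D2\<close>,
  \<open>D3\<close>.\<close>

lemma holomorphic3_identity_box:
  assumes f: "holomorphic3_on f (D1 \<times> D2 \<times> D3)" and g: "holomorphic3_on g (D1 \<times> D2 \<times> D3)"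
    and D: "open D1" "connected D1" "open D2" "connected D2" "open D3" "connected D3"
    and E: "open E1" "E1 \<noteq> {}" "E1 \<subseteq> D1" "open E2" "E2 \<noteq> {}" "E2 \<subseteq> D2" "open E3" "E3 \<noteq> {}" "E3 \<subseteq> D3"
    and eq: "\<And>p. p \<in> E1 \<times> E2 \<times> E3 \<Longrightarrow> f p = g p" and p: "p \<in> D1 \<times> D2 \<times> D3"
  shows "f p = g p"
proof -
  have o: "open (D1 \<times> D2 \<times> D3)" by (intro open_Times D)
  note f' = f[unfolded holomorphic3_on_iff[OF o]] and g' = g[unfolded holomorphic3_on_iff[OF o]]
  have 1: "f (x, y, z) = g (x, y, z)" if "x \<in> D1" "y \<in> E2" "z \<in> E3" for x y z
    by (rule analytic_continuation_open[where f = "\<lambda>t. f (t, y, z)" and g = "\<lambda>t. g (t, y, z)" and s = E1 and s' = D1])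
       (use that D E eq in \<open>auto intro!: holomorphic_on_subset[OF f'[THEN conjunct2, THEN conjunct1, rule_format]]
         holomorphic_on_subset[OF g'[THEN conjunct2, THEN conjunct1, rule_format]]\<close>)
  have 2: "f (x, y, z) = g (x, y, z)" if "x \<in> D1" "y \<in> D2" "z \<in> E3" for x y z
    by (rule analytic_continuation_open[where f = "\<lambda>t. f (x, t, z)" and g = "\<lambda>t. g (x, t, z)" and s = E2 and s' = D2])
       (use that D E 1 in \<open>auto intro!: holomorphic_on_subset[OF f'[THEN conjunct2, THEN conjunct2, THEN conjunct1, rule_format]]
         holomorphic_on_subset[OF g'[THEN conjunct2, THEN conjunct2, THEN conjunct1, rule_format]]\<close>)
  have 3: "f (x, y, z) = g (x, y, z)" if "x \<in> D1" "y \<in> D2" "z \<in> D3" for x y z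
    by (rule analytic_continuation_open[where f = "\<lambda>t. f (x, y, t)" and g = "\<lambda>t. g (x, y, t)" and s = E3 and s' = D3])
       (use that D E 2 in \<open>auto intro!: holomorphic_on_subset[OF f'[THEN conjunct2, THEN conjunct2, THEN conjunct2, rule_format]]
         holomorphic_on_subset[OF g'[THEN conjunct2, THEN conjunct2, THEN conjunct2, rule_format]]\<close>)
  show ?thesis using p 3 by (cases p) auto
qed

text \<open>Agreement near one point of a polydisc in S spreads over the polydisc by the product
  case, and connectedness of S carries it from polydisc to polydisc.\<close>

lemma holomorphic3_identity:
  assumes f: "holomorphic3_on f S" and g: "holomorphic3_on g S"
    and S: "open S" "connected S" and W: "open W" "W \<noteq> {}" "W \<subseteq> S"
    and eq: "\<And>p. p \<in> W \<Longrightarrow> f p = g p" and p: "p \<in> S"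
  shows "f p = g p"
proof -
  obtain w where w: "w \<in> W" using W by auto
  have "\<forall>\<^sub>F q in nhds p. f q = g q"
  proof (rule connected_induction_simple[OF S(2) _ p, where P = "\<lambda>p. \<forall>\<^sub>F q in nhds p. f q = g q"])
    show "w \<in> S" using w W by auto
    show "\<forall>\<^sub>F q in nhds w. f q = g q"
      by (rule eventually_mono[OF eventually_nhds_in_open[OF W(1) w] eq])
    fix s assume s: "s \<in> S"
    obtain a b c where abc: "s = (a, b, c)" by (cases s)
    obtain r where r: "r > 0" "ball a r \<times> ball b r \<times> ball c r \<subseteq> S"
      by (rule open_box_subset[OF S(1) s[unfolded abc]])
    define T where "T = ball a r \<times> ball b r \<times> ball c r"
    have T: "open T" "s \<in> T" "T \<subseteq> S" using r by (auto simp: T_def abc intro!: open_Times)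
    have *: "\<forall>\<^sub>F q in nhds y. f q = g q" if xy: "x \<in> T" "y \<in> T" and x: "\<forall>\<^sub>F q in nhds x. f q = g q" for x y
    proof -
      obtain N where N: "open N" "x \<in> N" "\<And>q. q \<in> N \<Longrightarrow> f q = g q"
        using x unfolding eventually_nhds by blast
      obtain x1 x2 x3 where x123: "x = (x1, x2, x3)" by (cases x)
      obtain e where e: "e > 0" "ball x1 e \<times> ball x2 e \<times> ball x3 e \<subseteq> N \<inter> T"
        by (rule open_box_subset[of "N \<inter> T" x1 x2 x3]) (use N(1,2) T(1) xy(1) x123 in auto)
      have sub: "ball x1 e \<subseteq> ball a r" "ball x2 e \<subseteq> ball b r" "ball x3 e \<subseteq> ball c r"
      proof -
        have *: "u \<in> ball a r \<and> v \<in> ball b r \<and> w \<in> ball c r"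
          if "u \<in> ball x1 e" "v \<in> ball x2 e" "w \<in> ball x3 e" for u v w
        proof -
          have "(u, v, w) \<in> N \<inter> T" using that by (intro subsetD[OF e(2)] SigmaI)
          hence "(u, v, w) \<in> T" by (rule IntD2)
          thus ?thesis unfolding T_def mem_Sigma_iff .
        qed
        have c: "x1 \<in> ball x1 e" "x2 \<in> ball x2 e" "x3 \<in> ball x3 e" using e(1) by simp_all
        show "ball x1 e \<subseteq> ball a r" by (rule subsetI) (rule *[OF _ c(2,3), THEN conjunct1])
        show "ball x2 e \<subseteq> ball b r" by (rule subsetI) (rule *[OF c(1) _ c(3), THEN conjunct2, THEN conjunct1])
        show "ball x3 e \<subseteq> ball c r" by (rule subsetI) (rule *[OF c(1,2), THEN conjunct2, THEN conjunct2])
      qed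
      have "f q = g q" if "q \<in> T" for q
      proof (rule holomorphic3_identity_box[where f = f and g = g])
        show "holomorphic3_on f (ball a r \<times> ball b r \<times> ball c r)" "holomorphic3_on g (ball a r \<times> ball b r \<times> ball c r)"
          by (rule holomorphic3_on_subset[OF f r(2)], rule holomorphic3_on_subset[OF g r(2)])
        show "q \<in> ball a r \<times> ball b r \<times> ball c r" using that by (simp add: T_def)
        show "f p = g p" if "p \<in> ball x1 e \<times> ball x2 e \<times> ball x3 e" for p
          using that N(3) e(2) by (meson IntD1 subsetD)
      qed (use sub e(1) in \<open>simp_all add: not_le\<close>)
      thus ?thesis unfolding eventually_nhds using T(1) xy(2) by (intro exI[of _ T]) simp
    qed
    show "\<exists>T. openin (top_of_set S) T \<and> s \<in> T \<and>
      (\<forall>x\<in>T. \<forall>y\<in>T. (\<forall>\<^sub>F q in nhds x. f q = g q) \<longrightarrow> (\<forall>\<^sub>F q in nhds y. f q = g q))"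
      using T openin_open_eq[OF S(1)] by (intro exI[of _ T] conjI ballI impI) (simp, simp, rule *)
  qed
  thus ?thesis by (rule eventually_nhds_x_imp_x)
qed

subsection \<open>The complement of the polar hyperplanes\<close>

text \<open>The zeros are the hyperplanes \<open>c = 1\<close>, \<open>b + c = 2 - k\<close> and \<open>a + b + c = 3 - k\<close> for \<open>k \<ge> 0\<close>.\<close>
definition polar_fun :: "complex \<times> complex \<times> complex \<Rightarrow> complex" where
  "polar_fun = (\<lambda>(a, b, c). (c - 1) * rGamma (b + c - 2) * rGamma (a + b + c - 3))"

text \<open>Cutting out all hyperplanes by one entire function, built from \<open>rGamma\<close>
  with its zeros at the non-positive integers, gives openness by continuity and reduces the polar
  set on a complex line to the zeros of an entire function of one variable.\<close>

definition regular_set :: "(complex \<times> complex \<times> complex) set" where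
  "regular_set = {p. polar_fun p \<noteq> 0}"

lemma regular_set_iff:
  "(a, b, c) \<in> regular_set \<longleftrightarrow> c \<noteq> 1 \<and> b + c - 2 \<notin> \<int>\<^sub>\<le>\<^sub>0 \<and> a + b + c - 3 \<notin> \<int>\<^sub>\<le>\<^sub>0"
  by (auto simp: regular_set_def polar_fun_def rGamma_eq_zero_iff)

lemma open_regular_set: "open regular_set"
  unfolding regular_set_def polar_fun_def case_prod_unfold
  by (intro open_Collect_neq continuous_intros continuous_on_compose2[OF continuous_on_rGamma[of UNIV]]) auto

text \<open>The parameter is complex because the polar set can cut a real segment in two, whereas
  countably many points do not disconnect an open part of the plane.\<close>

definition complex_line ::
  "complex \<times> complex \<times> complex \<Rightarrow> complex \<times> complex \<times> complex \<Rightarrow> complex \<Rightarrow> complex \<times> complex \<times> complex" where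
  "complex_line = (\<lambda>(a, b, c) (a', b', c') t. (a + t * (a' - a), b + t * (b' - b), c + t * (c' - c)))"

lemma complex_line_simps [simp]: "complex_line p q 0 = p" "complex_line p q 1 = q"
  by (auto simp: complex_line_def split: prod.splits)

lemma continuous_on_complex_line: "continuous_on A (complex_line p q)"
  unfolding complex_line_def case_prod_unfold by (intro continuous_intros)

lemma complex_line_convex_comb:
  fixes u v :: real
  assumes "u + v = 1"
  shows "complex_line p q (u *\<^sub>R s + v *\<^sub>R t) = u *\<^sub>R complex_line p q s + v *\<^sub>R complex_line p q t"
proof -
  have v: "v = 1 - u" using assms by simp
  show ?thesis
    unfolding v complex_line_def
    by (cases p; cases q) (simp add: scaleR_conv_of_real algebra_simps)
qed

text \<open>Along the line \<open>polar_fun\<close> is entire in t and non-zero at t0, so it is a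
  non-zero constant or has countably many zeros.\<close>

lemma countable_polar_line:
  assumes "complex_line p q t0 \<in> regular_set"
  shows "countable {t. complex_line p q t \<notin> regular_set}"
proof -
  define h where "h = (\<lambda>t. polar_fun (complex_line p q t))"
  have h: "h holomorphic_on UNIV"
    unfolding h_def polar_fun_def complex_line_def case_prod_unfold fst_conv snd_conv
    by (intro holomorphic_intros)
  have ev: "{t. complex_line p q t \<notin> regular_set} = {t\<in>UNIV. h t = 0}"
    by (auto simp: h_def regular_set_def)
  show ?thesis
  proof (cases "h constant_on UNIV")
    case True
    hence "h t \<noteq> 0" for t
      using assms unfolding constant_on_def h_def regular_set_def by (metis UNIV_I mem_Collect_eq)
    thus ?thesis unfolding ev by simp
  next
    case False
    thus ?thesis unfolding ev
      by (intro holomorphic_countable_zeros h) auto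
  qed
qed

text \<open>
  On the complex line through two regular points of a convex set, the polar set is countable, and
  a connected open subset of the plane stays connected when countably many points are removed.
\<close>
lemma connected_convex_Int_regular:
  assumes "convex C" "open C"
  shows "connected (C \<inter> regular_set)"
proof (cases "C \<inter> regular_set = {}")
  case False
  then obtain p where p: "p \<in> C" "p \<in> regular_set" by auto
  have "\<exists>T. connected T \<and> p \<in> T \<and> q \<in> T \<and> T \<subseteq> C \<inter> regular_set" if q: "q \<in> C \<inter> regular_set" for q
  proof -
    define S where "S = {t. complex_line p q t \<in> C}"
    define Z where "Z = {t. complex_line p q t \<notin> regular_set}"
    have "open (complex_line p q -` C)"
      by (intro open_vimage assms continuous_on_complex_line)
    hence oS: "open S" by (simp add: S_def vimage_def)
    have "convex S"
    proof (rule convexI)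
      fix s t and u v :: real
      assume "s \<in> S" "t \<in> S" and uv: "0 \<le> u" "0 \<le> v" "u + v = 1"
      hence "u *\<^sub>R complex_line p q s + v *\<^sub>R complex_line p q t \<in> C"
        by (intro convexD[OF assms(1)]) (simp_all add: S_def)
      thus "u *\<^sub>R s + v *\<^sub>R t \<in> S"
        unfolding S_def mem_Collect_eq complex_line_convex_comb[OF uv(3)] .
    qed
    hence "connected (S - Z)"
      unfolding Z_def by (intro connected_open_diff_countable oS convex_connected countable_polar_line[of p q 0])
        (use p in auto)
    hence "connected (complex_line p q ` (S - Z))"
      by (intro connected_continuous_image continuous_on_complex_line)
    moreover have "0 \<in> S - Z" "1 \<in> S - Z" using p q by (simp_all add: S_def Z_def)
    from imageI[OF this(1), of "complex_line p q"] imageI[OF this(2), of "complex_line p q"]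
    have "p \<in> complex_line p q ` (S - Z)" "q \<in> complex_line p q ` (S - Z)"
      unfolding complex_line_simps .
    moreover have "complex_line p q ` (S - Z) \<subseteq> C \<inter> regular_set" by (auto simp: S_def Z_def)
    ultimately show ?thesis by blast
  qed
  hence *: "connected_component (C \<inter> regular_set) p q" if "q \<in> C \<inter> regular_set" for q
    using that unfolding connected_component_def by blast
  show ?thesis
    unfolding connected_iff_connected_component
    by (intro ballI connected_component_trans[OF connected_component_sym[OF *] *])
qed auto

text \<open>Join a point of W to the regular point (2, 2, 2): the parameters that stay in W contain
  a disc, hence are uncountable, while those hitting the polar set are countable.\<close>

lemma regular_set_dense:
  assumes "open W" "W \<noteq> {}"
  shows "W \<inter> regular_set \<noteq> {}"
proof -
  obtain p where p: "p \<in> W" using assms by auto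
  define q :: "complex \<times> complex \<times> complex" where "q = (2, 2, 2)"
  have "q \<in> regular_set"
    by (auto simp: q_def regular_set_iff elim!: nonpos_Ints_cases)
  hence c: "countable {t. complex_line p q t \<notin> regular_set}"
    by (intro countable_polar_line[of p q 1]) simp
  have "open (complex_line p q -` W)"
    by (intro open_vimage assms continuous_on_complex_line)
  moreover have "0 \<in> complex_line p q -` W" using p by simp
  ultimately obtain r where "r > 0" "ball 0 r \<subseteq> complex_line p q -` W"
    by (metis open_contains_ball_eq)
  hence "uncountable (complex_line p q -` W)"
    using uncountable_ball countable_subset by blast
  hence "\<not> complex_line p q -` W \<subseteq> {t. complex_line p q t \<notin> regular_set}"
    using c countable_subset by blast
  thus ?thesis by auto
qed

text \<open>
  The set \<open>U \<inter> regular_set\<close> need not be treated globally: agreement off the polar set spreads from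
  ball to ball inside \<open>U\<close>, because each ball minus the polar set is connected.
\<close>
lemma regular_set_continuation_unique:
  assumes g: "holomorphic3_on g U" and F: "holomorphic3_on F regular_set"
    and U: "open U" "connected U" and W: "open W" "W \<noteq> {}" "W \<subseteq> U"
    and eq: "\<And>p. p \<in> W \<Longrightarrow> g p = F p" and p: "p \<in> U" "p \<in> regular_set"
  shows "g p = F p"
proof -
  obtain w where w: "w \<in> W" using W by auto
  \<comment> \<open>The implication makes the property meaningful at polar points of U as well, so
    the induction runs over the connected set U itself.\<close>
  have "\<forall>\<^sub>F q in nhds p. q \<in> regular_set \<longrightarrow> g q = F q"
  proof (rule connected_induction_simple[OF U(2) _ p(1),
        where P = "\<lambda>p. \<forall>\<^sub>F q in nhds p. q \<in> regular_set \<longrightarrow> g q = F q"])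
    show "w \<in> U" using w W by auto
    show "\<forall>\<^sub>F q in nhds w. q \<in> regular_set \<longrightarrow> g q = F q"
      by (rule eventually_mono[OF eventually_nhds_in_open[OF W(1) w]]) (simp add: eq)
    fix s assume s: "s \<in> U"
    obtain r where r: "r > 0" "ball s r \<subseteq> U" using U s by (metis open_contains_ball_eq)
    have *: "\<forall>\<^sub>F q in nhds y. q \<in> regular_set \<longrightarrow> g q = F q"
      if xy: "x \<in> ball s r" "y \<in> ball s r" and x: "\<forall>\<^sub>F q in nhds x. q \<in> regular_set \<longrightarrow> g q = F q" for x y
    proof -
      obtain N where N: "open N" "x \<in> N" "\<And>q. q \<in> N \<Longrightarrow> q \<in> regular_set \<Longrightarrow> g q = F q"
        using x unfolding eventually_nhds by blast
      have ne: "N \<inter> ball s r \<inter> regular_set \<noteq> {}"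
        by (rule regular_set_dense) (use N(1,2) xy(1) in auto)
      have "g q = F q" if q: "q \<in> ball s r \<inter> regular_set" for q
      proof (rule holomorphic3_identity[where f = g and g = F and S = "ball s r \<inter> regular_set"
            and W = "N \<inter> ball s r \<inter> regular_set"])
        show "holomorphic3_on g (ball s r \<inter> regular_set)"
          by (rule holomorphic3_on_subset[OF g]) (use r in blast)
        show "holomorphic3_on F (ball s r \<inter> regular_set)"
          by (rule holomorphic3_on_subset[OF F]) blast
        show "connected (ball s r \<inter> regular_set)"
          by (intro connected_convex_Int_regular convex_ball open_ball)
        show "g p = F p" if "p \<in> N \<inter> ball s r \<inter> regular_set" for p
          using that N(3) by blast
        show "N \<inter> ball s r \<inter> regular_set \<subseteq> ball s r \<inter> regular_set" by blast
      qed (use ne q N(1) open_regular_set in \<open>simp_all add: open_Int\<close>)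
      thus ?thesis unfolding eventually_nhds using xy(2) by (intro exI[of _ "ball s r"]) simp
    qed
    show "\<exists>T. openin (top_of_set U) T \<and> s \<in> T \<and> (\<forall>x\<in>T. \<forall>y\<in>T.
        (\<forall>\<^sub>F q in nhds x. q \<in> regular_set \<longrightarrow> g q = F q) \<longrightarrow>
        (\<forall>\<^sub>F q in nhds y. q \<in> regular_set \<longrightarrow> g q = F q))"
      using r openin_open_eq[OF U(1)] by (intro exI[of _ "ball s r"] conjI ballI impI) (simp, simp, rule *)
  qed
  thus ?thesis using p by (auto dest: eventually_nhds_x_imp_x)
qed

subsection \<open>Families dominated by powers\<close>

text \<open>The exponent varies with the parameter, so convergence of nested sums becomes arithmetic
  of exponents: a factor n^(-l) adds Re l, passing to the tail sum subtracts 1, and an exponent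
  above 1 gives a local majorant.\<close>

definition powr_dominated :: "(nat \<Rightarrow> 'a::topological_space \<Rightarrow> complex) \<Rightarrow> ('a \<Rightarrow> real) \<Rightarrow> 'a set \<Rightarrow> bool" where
  "powr_dominated f \<rho> U \<longleftrightarrow>
     (\<forall>p\<in>U. \<exists>C\<ge>0. \<forall>\<^sub>F q in nhds p. \<forall>n\<ge>1. norm (f n q) \<le> C * real n powr (- \<rho> q))"

lemma continuous_on_open_tendsto_nhds:
  fixes f :: "'a::t2_space \<Rightarrow> 'b::t2_space"
  shows "continuous_on U f \<Longrightarrow> open U \<Longrightarrow> p \<in> U \<Longrightarrow> (f \<longlongrightarrow> f p) (nhds p)"
  by (simp add: continuous_on_eq_continuous_at isCont_def tendsto_nhds_iff)

lemma powr_dominated_majorant: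
  fixes U :: "'a::t2_space set"
  assumes "powr_dominated f \<rho> U" "open U" "continuous_on U \<rho>" "p \<in> U" "\<rho> p > 1" "A \<subseteq> {1..}"
  shows "\<exists>M. M summable_on A \<and> (\<forall>\<^sub>F q in nhds p. \<forall>n\<in>A. norm (f n q) \<le> M n)"
proof -
  obtain C where C: "C \<ge> 0" "\<forall>\<^sub>F q in nhds p. \<forall>n\<ge>1. norm (f n q) \<le> C * real n powr (- \<rho> q)"
    using assms(1,4) unfolding powr_dominated_def by blast
  define \<tau> where "\<tau> = (\<rho> p + 1) / 2"
  have t: "\<tau> > 1" "\<tau> < \<rho> p" using assms by (auto simp: \<tau>_def)
  have "\<forall>\<^sub>F q in nhds p. \<tau> < \<rho> q"
    using order_tendstoD(1)[OF continuous_on_open_tendsto_nhds[OF assms(3,2,4)] t(2)] .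
  with C(2) have "\<forall>\<^sub>F q in nhds p. \<forall>n\<in>A. norm (f n q) \<le> C * real n powr (-\<tau>)"
  proof eventually_elim
    case (elim q)
    show ?case
    proof
      fix n assume "n \<in> A"
      hence n: "n \<ge> 1" using assms by auto
      hence "norm (f n q) \<le> C * real n powr (- \<rho> q)" using elim by auto
      also have "\<dots> \<le> C * real n powr (-\<tau>)"
        using n elim C by (intro mult_left_mono powr_mono) auto
      finally show "norm (f n q) \<le> C * real n powr (-\<tau>)" .
    qed
  qed
  moreover have "(\<lambda>n. real n powr (-\<tau>)) summable_on insert 1 {1<..}"
    using powr_tail(1)[OF t(1), of 1] by (simp add: summable_on_insert_iff)
  hence "(\<lambda>n. real n powr (-\<tau>)) summable_on A"
    by (rule summable_on_subset_banach) (use assms in auto)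
  hence "(\<lambda>n. C * real n powr (-\<tau>)) summable_on A"
    by (rule summable_on_cmult_right)
  ultimately show ?thesis by blast
qed

lemma powr_dominated_summable:
  fixes U :: "'a::t2_space set"
  assumes "powr_dominated f \<rho> U" "open U" "continuous_on U \<rho>" "p \<in> U" "\<rho> p > 1" "A \<subseteq> {1..}"
  shows "(\<lambda>n. f n p) summable_on A"
proof -
  obtain M where M: "M summable_on A" "\<forall>\<^sub>F q in nhds p. \<forall>n\<in>A. norm (f n q) \<le> M n"
    using powr_dominated_majorant[OF assms] by blast
  have "norm (f n p) \<le> M n" if "n \<in> A" for n
    using eventually_nhds_x_imp_x[OF M(2)] that by blast
  hence "(\<lambda>n. norm (f n p)) summable_on A"
    by (intro summable_on_comparison_test[OF M(1)]) auto
  thus ?thesis by (rule abs_summable_summable)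
qed

lemma powr_dominated_tail:
  fixes U :: "'a::t2_space set"
  assumes "powr_dominated f \<rho> U" "open U" "continuous_on U \<rho>" "\<And>p. p \<in> U \<Longrightarrow> \<rho> p > 1"
  shows "powr_dominated (\<lambda>N q. \<Sum>\<^sub>\<infinity>n\<in>{N<..}. f n q) (\<lambda>q. \<rho> q - 1) U"
  unfolding powr_dominated_def
proof
  fix p assume p: "p \<in> U"
  obtain C where C: "C \<ge> 0" "\<forall>\<^sub>F q in nhds p. \<forall>n\<ge>1. norm (f n q) \<le> C * real n powr (- \<rho> q)"
    using assms(1) p unfolding powr_dominated_def by blast
  define e where "e = (\<rho> p - 1) / 2"
  have e: "e > 0" "1 + e < \<rho> p" using assms(4)[OF p] by (auto simp: e_def field_simps)
  have "\<forall>\<^sub>F q in nhds p. 1 + e < \<rho> q"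
    using order_tendstoD(1)[OF continuous_on_open_tendsto_nhds[OF assms(3,2) p] e(2)] .
  with C(2) have "\<forall>\<^sub>F q in nhds p. \<forall>N\<ge>1. norm (\<Sum>\<^sub>\<infinity>n\<in>{N<..}. f n q) \<le> C / e * real N powr (- (\<rho> q - 1))"
  proof eventually_elim
    case (elim q)
    show ?case
    proof safe
      fix N :: nat assume N: "N \<ge> 1"
      have "norm (\<Sum>\<^sub>\<infinity>n\<in>{N<..}. f n q) \<le> C * real N powr (1 - \<rho> q) / (\<rho> q - 1)"
        using elim N e by (intro tail_infsum) auto
      also have "\<dots> \<le> C * real N powr (1 - \<rho> q) / e"
        using C e elim by (intro divide_left_mono mult_pos_pos) auto
      finally show "norm (\<Sum>\<^sub>\<infinity>n\<in>{N<..}. f n q) \<le> C / e * real N powr (- (\<rho> q - 1))" by simp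
    qed
  qed
  thus "\<exists>C\<ge>0. \<forall>\<^sub>F q in nhds p. \<forall>N\<ge>1. norm (\<Sum>\<^sub>\<infinity>n\<in>{N<..}. f n q) \<le> C * real N powr (- (\<rho> q - 1))"
    using C e by (intro exI[of _ "C / e"]) auto
qed

lemma powr_dominated_mult_powr:
  assumes "powr_dominated f \<rho> U"
  shows "powr_dominated (\<lambda>n q. of_nat n powr (- l q) * f n q) (\<lambda>q. Re (l q) + \<rho> q) U"
  unfolding powr_dominated_def
proof
  fix p assume p: "p \<in> U"
  obtain C where C: "C \<ge> 0" "\<forall>\<^sub>F q in nhds p. \<forall>n\<ge>1. norm (f n q) \<le> C * real n powr (- \<rho> q)"
    using assms(1) p unfolding powr_dominated_def by blast
  from C(2) have "\<forall>\<^sub>F q in nhds p. \<forall>n\<ge>1. norm (of_nat n powr (- l q) * f n q) \<le> C * real n powr (- (Re (l q) + \<rho> q))"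
  proof eventually_elim
    case (elim q)
    show ?case
    proof safe
      fix n :: nat assume n: "n \<ge> 1"
      have "norm (of_nat n powr (- l q) * f n q) \<le> real n powr (- Re (l q)) * (C * real n powr (- \<rho> q))"
        using elim n by (auto simp: norm_mult norm_of_nat_powr intro!: mult_left_mono)
      also have "\<dots> = C * (real n powr (- Re (l q)) * real n powr (- \<rho> q))" by simp
      also have "real n powr (- Re (l q)) * real n powr (- \<rho> q) = real n powr (- (Re (l q) + \<rho> q))"
        by (simp flip: powr_add)
      finally show "norm (of_nat n powr (- l q) * f n q) \<le> C * real n powr (- (Re (l q) + \<rho> q))" .
    qed
  qed
  thus "\<exists>C\<ge>0. \<forall>\<^sub>F q in nhds p. \<forall>n\<ge>1. norm (of_nat n powr (- l q) * f n q) \<le> C * real n powr (- (Re (l q) + \<rho> q))"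
    using C by blast
qed

lemma powr_dominated_em_rest:
  fixes U :: "'a::t2_space set"
  assumes "open U" "continuous_on U l" "\<And>p. p \<in> U \<Longrightarrow> l p \<noteq> 1" "\<And>p. p \<in> U \<Longrightarrow> Re (l p) > 1 - real K"
  shows "powr_dominated (\<lambda>n q. em_rest K (l q) n) (\<lambda>q. Re (l q) + real K - 1) U"
  unfolding powr_dominated_def
proof
  fix p assume p: "p \<in> U"
  obtain C where C: "C \<ge> 0" "\<forall>\<^sub>F s in nhds (l p). \<forall>N\<ge>1. norm (em_rest K s N) \<le> C * real N powr (1 - Re s - real K)"
    using em_rest_bound[OF assms(3)[OF p] assms(4)[OF p]] by blast
  have "\<forall>\<^sub>F q in nhds p. \<forall>N\<ge>1. norm (em_rest K (l q) N) \<le> C * real N powr (1 - Re (l q) - real K)"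
    by (rule eventually_compose_filterlim[OF C(2) continuous_on_open_tendsto_nhds[OF assms(2,1) p]])
  moreover have "1 - Re (l q) - real K = - (Re (l q) + real K - 1)" for q by simp
  ultimately show "\<exists>C\<ge>0. \<forall>\<^sub>F q in nhds p. \<forall>n\<ge>1. norm (em_rest K (l q) n) \<le> C * real n powr (- (Re (l q) + real K - 1))"
    using C(1) by auto
qed

lemma holomorphic3_powr_dominated_infsum:
  assumes "powr_dominated f \<rho> U" "open U" "continuous_on U \<rho>" "\<And>p. p \<in> U \<Longrightarrow> \<rho> p > 1" "A \<subseteq> {1..}"
    and "\<And>n. n \<in> A \<Longrightarrow> holomorphic3_on (f n) U"
  shows "holomorphic3_on (\<lambda>q. \<Sum>\<^sub>\<infinity>n\<in>A. f n q) U"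
  by (rule holomorphic3_infsum) (use assms powr_dominated_majorant[OF assms(1-3)] in auto)

subsection \<open>Continuation of the double and triple zeta functions\<close>

lemma holomorphic3_on_imp_continuous_on: "holomorphic3_on f U \<Longrightarrow> continuous_on U f"
  by (simp add: holomorphic3_on_def)

lemma holomorphic3_of_nat_powr [holomorphic3_intros]:
  assumes "open U" "holomorphic3_on l U" "n \<ge> 1"
  shows "holomorphic3_on (\<lambda>p. of_nat n powr (- l p)) U"
proof (rule holomorphic3_compose[OF assms(1) _ assms(2)])
  show "(\<lambda>s. of_nat n powr (- s)) holomorphic_on UNIV"
    using assms(3) by (intro holomorphic_intros) auto
qed auto

lemma holomorphic3_em_coeff [holomorphic3_intros]:
  assumes "open U" "holomorphic3_on l U" "\<And>p. p \<in> U \<Longrightarrow> l p \<noteq> 1"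
  shows "holomorphic3_on (\<lambda>p. em_coeff k (l p)) U"
proof (rule holomorphic3_compose[OF assms(1) _ assms(2)])
  show "em_coeff k holomorphic_on - {1}"
    by (rule holomorphic_em_coeff[OF holomorphic_on_ident]) auto
qed (use assms in auto)

lemma holomorphic3_riemann_zeta [holomorphic3_intros]:
  assumes "open U" "holomorphic3_on l U" "\<And>p. p \<in> U \<Longrightarrow> l p \<noteq> 1"
  shows "holomorphic3_on (\<lambda>p. riemann_zeta (l p)) U"
  by (rule holomorphic3_compose[OF assms(1) holomorphic_riemann_zeta assms(2)]) (use assms in auto)

lemma holomorphic3_em_rest [holomorphic3_intros]:
  assumes "open U" "holomorphic3_on l U" "\<And>p. p \<in> U \<Longrightarrow> l p \<noteq> 1" "\<And>p. p \<in> U \<Longrightarrow> Re (l p) > 1 - real K" "N \<ge> 1"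
  shows "holomorphic3_on (\<lambda>p. em_rest K (l p) N) U"
  by (rule holomorphic3_compose[OF assms(1) holomorphic_em_rest[OF assms(5), of K] assms(2)]) (use assms in auto)

text \<open>The double zeta function: inserting the expansion of the tail over m > n into the sum
  over n produces n^(-(a + b - 1 + k)), and summation over n gives the zeta values.\<close>

definition em_zeta2 :: "nat \<Rightarrow> complex \<Rightarrow> complex \<Rightarrow> complex" where
  "em_zeta2 K a b = (\<Sum>k<K. em_coeff k b * riemann_zeta (a + b - 1 + of_nat k)) +
     (\<Sum>\<^sub>\<infinity>n\<in>{1..}. of_nat n powr (- a) * em_rest K b n)"

text \<open>The expansion of the innermost tail turns n2^(-b) into n2^(-(b + c - 1 + k)), which
  leaves double zeta functions. The same order K serves for them, since the shift by k \<ge> 0 only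
  moves their second argument to the right.\<close>

definition em_zeta3 :: "nat \<Rightarrow> complex \<Rightarrow> complex \<Rightarrow> complex \<Rightarrow> complex" where
  "em_zeta3 K a b c = (\<Sum>k<K. em_coeff k c * em_zeta2 K a (b + c - 1 + of_nat k)) +
     (\<Sum>\<^sub>\<infinity>n1\<in>{1..}. of_nat n1 powr (- a) * (\<Sum>\<^sub>\<infinity>n2\<in>{n1<..}. of_nat n2 powr (- b) * em_rest K c n2))"

text \<open>The arguments are arbitrary holomorphic functions so that both the shifted second
  argument inside \<open>em_zeta3\<close> and a frozen first argument fit.\<close>

lemma holomorphic3_em_zeta2:
  assumes U: "open U" and l1: "holomorphic3_on l1 U" and l2: "holomorphic3_on l2 U"
    and h: "\<And>p. p \<in> U \<Longrightarrow> l2 p \<noteq> 1" "\<And>p. p \<in> U \<Longrightarrow> Re (l2 p) > 1 - real K"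
      "\<And>p. p \<in> U \<Longrightarrow> Re (l1 p + l2 p) > 2 - real K"
      "\<And>p k. p \<in> U \<Longrightarrow> k < K \<Longrightarrow> l1 p + l2 p - 1 + of_nat k \<noteq> 1"
  shows "holomorphic3_on (\<lambda>p. em_zeta2 K (l1 p) (l2 p)) U"
  unfolding em_zeta2_def
proof (intro holomorphic3_intros U l1 l2 h)
  note c = holomorphic3_on_imp_continuous_on[OF l1] holomorphic3_on_imp_continuous_on[OF l2]
  show "holomorphic3_on (\<lambda>p. \<Sum>\<^sub>\<infinity>n\<in>{1..}. of_nat n powr (- l1 p) * em_rest K (l2 p) n) U"
    by (rule holomorphic3_powr_dominated_infsum[OF powr_dominated_mult_powr[OF
          powr_dominated_em_rest[OF U c(2) h(1,2)]] U])
       (use h in \<open>auto intro!: continuous_intros c holomorphic3_intros U l1 l2 simp: algebra_simps\<close>)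
qed auto

text \<open>The three inequalities are the convergence conditions at order K of the remainder sums
  over n3, n2 and n1. For K = 0 they describe absolute convergence of the triple series.\<close>

definition em_domain :: "nat \<Rightarrow> (complex \<times> complex \<times> complex) set" where
  "em_domain K = {(a, b, c). Re c > 1 - real K \<and> Re (b + c) > 2 - real K \<and> Re (a + b + c) > 3 - real K}"

lemma em_domain_mono: "K \<le> L \<Longrightarrow> em_domain K \<subseteq> em_domain L"
  by (auto simp: em_domain_def)

lemma open_em_domain: "open (em_domain K)"
  unfolding em_domain_def case_prod_unfold
  by (intro open_Collect_conj open_Collect_less continuous_intros)

lemma convex_em_domain: "convex (em_domain K)"
proof -
  have "em_domain K = (\<lambda>p. Re (snd (snd p))) -` {1 - real K<..} \<inter>
      (\<lambda>p. Re (fst (snd p) + snd (snd p))) -` {2 - real K<..} \<inter>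
      (\<lambda>p. Re (fst p + fst (snd p) + snd (snd p))) -` {3 - real K<..}"
    by (auto simp: em_domain_def)
  moreover have "linear (\<lambda>p::complex \<times> complex \<times> complex. Re (snd (snd p)))"
    "linear (\<lambda>p::complex \<times> complex \<times> complex. Re (fst (snd p) + snd (snd p)))"
    "linear (\<lambda>p::complex \<times> complex \<times> complex. Re (fst p + fst (snd p) + snd (snd p)))"
    by (auto intro!: linearI simp: algebra_simps)
  ultimately show ?thesis
    by (simp add: convex_Int convex_linear_vimage)
qed

text \<open>These are the forms in which singularities enter \<open>em_zeta3\<close>: the argument
  of its own coefficients, the second argument of \<open>em_zeta2\<close>, and the argument of the
  zeta values, where k is the sum of two expansion indices.\<close>

lemma regular_setD:
  assumes "(a, b, c) \<in> regular_set"
  shows "c \<noteq> 1" "b + c - 1 + of_nat k \<noteq> 1" "a + b + c - 2 + of_nat k \<noteq> 1"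
proof -
  have n: "z + of_nat k \<noteq> 0" if "z \<notin> \<int>\<^sub>\<le>\<^sub>0" for z :: complex
    using that by (metis add_eq_0_iff2 minus_of_nat_in_nonpos_Ints)
  show "c \<noteq> 1" using assms by (simp add: regular_set_iff)
  show "b + c - 1 + of_nat k \<noteq> 1"
    using assms n[of "b + c - 2"] by (auto simp: regular_set_iff algebra_simps)
  show "a + b + c - 2 + of_nat k \<noteq> 1"
    using assms n[of "a + b + c - 3"] by (auto simp: regular_set_iff algebra_simps)
qed

lemma em_domain_0_subset: "em_domain 0 \<subseteq> regular_set"
proof
  fix p assume "p \<in> em_domain 0"
  then obtain a b c where p: "p = (a, b, c)" "Re c > 1" "Re (b + c) > 2" "Re (a + b + c) > 3"
    by (auto simp: em_domain_def)
  have "z \<notin> \<int>\<^sub>\<le>\<^sub>0" if "Re z > 0" for z :: complex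
    using that by (auto elim!: nonpos_Ints_cases)
  from this[of "b + c - 2"] this[of "a + b + c - 3"] show "p \<in> regular_set"
    using p by (auto simp: regular_set_iff)
qed

lemma holomorphic3_em_zeta3:
  "holomorphic3_on (\<lambda>p. em_zeta3 K (fst p) (fst (snd p)) (snd (snd p))) (em_domain K \<inter> regular_set)"
proof -
  define U where "U = em_domain K \<inter> regular_set"
  have U: "open U" by (simp add: U_def open_em_domain open_regular_set open_Int)
  have r: "snd (snd p) \<noteq> 1" "fst (snd p) + snd (snd p) - 1 + of_nat k \<noteq> 1"
    "fst p + fst (snd p) + snd (snd p) - 2 + of_nat k \<noteq> 1"
    "Re (snd (snd p)) > 1 - real K" "Re (fst (snd p)) + Re (snd (snd p)) > 2 - real K"
    "Re (fst p) + Re (fst (snd p)) + Re (snd (snd p)) > 3 - real K"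
    if "p \<in> U" for p :: "complex \<times> complex \<times> complex" and k
    using that regular_setD(1)[of "fst p" "fst (snd p)" "snd (snd p)"]
      regular_setD(2,3)[of "fst p" "fst (snd p)" "snd (snd p)" k] by (auto simp: U_def em_domain_def)
  have r': "fst p + (fst (snd p) + snd (snd p) - 1 + of_nat k) - 1 + of_nat j \<noteq> 1" if "p \<in> U" for p k j
    using r(3)[OF that, of "k + j"] by (simp add: algebra_simps)
  \<comment> \<open>The exponents of domination for the summand over n2 and, in \<open>d1\<close>,
    for the summand over n1; they exceed 1 exactly by the second and third inequality of
    \<open>em_domain\<close>.\<close>
  have d2: "powr_dominated (\<lambda>n q. of_nat n powr (- fst (snd q)) * em_rest K (snd (snd q)) n)
      (\<lambda>q. Re (fst (snd q)) + (Re (snd (snd q)) + real K - 1)) U"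
    by (intro powr_dominated_mult_powr powr_dominated_em_rest U continuous_intros r)
  have d1: "powr_dominated (\<lambda>n1 q. of_nat n1 powr (- fst q) *
         (\<Sum>\<^sub>\<infinity>n2\<in>{n1<..}. of_nat n2 powr (- fst (snd q)) * em_rest K (snd (snd q)) n2))
      (\<lambda>q. Re (fst q) + (Re (fst (snd q)) + (Re (snd (snd q)) + real K - 1) - 1)) U"
    by (intro powr_dominated_mult_powr powr_dominated_tail[OF d2 U] continuous_intros)
       (use r(5) in \<open>simp add: algebra_simps\<close>)
  have 1: "holomorphic3_on (\<lambda>p. em_zeta2 K (fst p) (fst (snd p) + snd (snd p) - 1 + of_nat k)) U" if "k < K" for k
  proof (rule holomorphic3_em_zeta2[OF U])
    fix p assume p: "p \<in> U"
    show "Re (fst (snd p) + snd (snd p) - 1 + of_nat k) > 1 - real K"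
      "Re (fst p + (fst (snd p) + snd (snd p) - 1 + of_nat k)) > 2 - real K"
      using r(5,6)[OF p] by auto
    show "fst (snd p) + snd (snd p) - 1 + of_nat k \<noteq> 1" by (rule r(2)[OF p])
    show "fst p + (fst (snd p) + snd (snd p) - 1 + of_nat k) - 1 + of_nat j \<noteq> 1" for j by (rule r'[OF p])
  qed (intro holomorphic3_intros U)+
  have 2: "holomorphic3_on (\<lambda>q. \<Sum>\<^sub>\<infinity>n2\<in>{n1<..}. of_nat n2 powr (- fst (snd q)) * em_rest K (snd (snd q)) n2) U"
    if "n1 \<in> {1..}" for n1
  proof (rule holomorphic3_powr_dominated_infsum[OF d2 U])
    show "Re (fst (snd p)) + (Re (snd (snd p)) + real K - 1) > 1" if "p \<in> U" for p
      using r(5)[OF that] by simp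
    show "holomorphic3_on (\<lambda>q. of_nat n powr (- fst (snd q)) * em_rest K (snd (snd q)) n) U" if "n \<in> {n1<..}" for n
      using that \<open>n1 \<in> {1..}\<close> by (intro holomorphic3_intros U r(1,4)) auto
  qed (use that in \<open>auto intro!: continuous_intros\<close>)
  have 3: "holomorphic3_on (\<lambda>q. \<Sum>\<^sub>\<infinity>n1\<in>{1..}. of_nat n1 powr (- fst q) *
         (\<Sum>\<^sub>\<infinity>n2\<in>{n1<..}. of_nat n2 powr (- fst (snd q)) * em_rest K (snd (snd q)) n2)) U"
  proof (rule holomorphic3_powr_dominated_infsum[OF d1 U])
    show "Re (fst p) + (Re (fst (snd p)) + (Re (snd (snd p)) + real K - 1) - 1) > 1" if "p \<in> U" for p
      using r(6)[OF that] by simp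
  qed (auto intro!: continuous_intros holomorphic3_mult holomorphic3_of_nat_powr holomorphic3_proj 2 U)
  show ?thesis
    unfolding em_zeta3_def U_def[symmetric]
    by (intro holomorphic3_add holomorphic3_sum holomorphic3_mult holomorphic3_em_coeff holomorphic3_proj 1 3 U r) auto
qed

lemma em_rest_summable:
  assumes "s \<noteq> 1" "Re s > 1 - real K" "Re t + Re s > 2 - real K" "A \<subseteq> {1..}"
  shows "(\<lambda>n. of_nat n powr (- t) * em_rest K s n) summable_on A"
proof -
  define U where "U = {s. s \<noteq> 1 \<and> Re s > 1 - real K}"
  have U: "open U" unfolding U_def
    by (intro open_Collect_conj open_Collect_neq open_Collect_less continuous_intros)
  have "powr_dominated (\<lambda>n s. of_nat n powr (- t) * em_rest K s n) (\<lambda>s. Re t + (Re s + real K - 1)) U"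
    using powr_dominated_mult_powr[where l = "\<lambda>_. t", OF powr_dominated_em_rest[OF U continuous_on_id]]
    by (auto simp: U_def)
  thus ?thesis
    by (rule powr_dominated_summable[OF _ U]) (use assms in \<open>auto intro!: continuous_intros simp: U_def\<close>)
qed

lemma em_rest_tail_summable:
  assumes "s \<noteq> 1" "Re s > 1 - real K" "Re t + Re s > 2 - real K" "Re u + Re t + Re s > 3 - real K" "A \<subseteq> {1..}"
  shows "(\<lambda>n. of_nat n powr (- u) * (\<Sum>\<^sub>\<infinity>m\<in>{n<..}. of_nat m powr (- t) * em_rest K s m)) summable_on A"
proof -
  define U where "U = {s. s \<noteq> 1 \<and> Re s > 1 - real K \<and> Re t + Re s > 2 - real K}"
  have U: "open U" unfolding U_def
    by (intro open_Collect_conj open_Collect_neq open_Collect_less continuous_intros)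
  have 1: "powr_dominated (\<lambda>n s. of_nat n powr (- t) * em_rest K s n) (\<lambda>s. Re t + (Re s + real K - 1)) U"
    using powr_dominated_mult_powr[where l = "\<lambda>_. t", OF powr_dominated_em_rest[OF U continuous_on_id]]
    by (auto simp: U_def)
  have "powr_dominated (\<lambda>n s. of_nat n powr (- u) * (\<Sum>\<^sub>\<infinity>m\<in>{n<..}. of_nat m powr (- t) * em_rest K s m))
     (\<lambda>s. Re u + (Re t + (Re s + real K - 1) - 1)) U"
  proof (rule powr_dominated_mult_powr[where l = "\<lambda>_. u", OF powr_dominated_tail[OF 1 U]])
    show "continuous_on U (\<lambda>s. Re t + (Re s + real K - 1))" by (intro continuous_intros)
  qed (auto simp: U_def)
  thus ?thesis
    by (rule powr_dominated_summable[OF _ U]) (use assms in \<open>auto intro!: continuous_intros simp: U_def\<close>)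
qed

lemma of_nat_powr_mult:
  "n \<ge> 1 \<Longrightarrow> of_nat n powr a * of_nat n powr b = (of_nat n powr (a + b) :: complex)"
  by (simp add: powr_add)

lemma infsum_sum:
  fixes f :: "'k \<Rightarrow> 'i \<Rightarrow> complex"
  assumes "finite F" "\<And>k. k \<in> F \<Longrightarrow> f k summable_on A"
  shows "(\<Sum>\<^sub>\<infinity>n\<in>A. \<Sum>k\<in>F. f k n) = (\<Sum>k\<in>F. \<Sum>\<^sub>\<infinity>n\<in>A. f k n)" "(\<lambda>n. \<Sum>k\<in>F. f k n) summable_on A"
proof -
  have "((\<lambda>n. \<Sum>k\<in>F. f k n) has_sum (\<Sum>k\<in>F. \<Sum>\<^sub>\<infinity>n\<in>A. f k n)) A"
    using assms by (induction F rule: finite_induct) (auto intro!: has_sum_add)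
  thus "(\<Sum>\<^sub>\<infinity>n\<in>A. \<Sum>k\<in>F. f k n) = (\<Sum>k\<in>F. \<Sum>\<^sub>\<infinity>n\<in>A. f k n)" "(\<lambda>n. \<Sum>k\<in>F. f k n) summable_on A"
    by (auto simp: has_sum_iff)
qed

text \<open>As \<open>em_rest 0 b n\<close> is the plain tail sum, the right side is the double
  series. Every piece of the expansion is separately summable here, so the sum over n may be taken
  termwise.\<close>

lemma em_zeta2_series:
  assumes "Re b > 1" "Re (a + b) > 2"
  shows "em_zeta2 K a b = (\<Sum>\<^sub>\<infinity>n\<in>{1..}. of_nat n powr (- a) * em_rest 0 b n)"
proof -
  have b: "b \<noteq> 1" using assms by auto
  have hs: "((\<lambda>n. of_nat n powr (- (a + b - 1 + of_nat k))) has_sum riemann_zeta (a + b - 1 + of_nat k)) {1::nat..}" for k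
    by (rule riemann_zeta_has_sum) (use assms in auto)
  have "(\<Sum>\<^sub>\<infinity>n\<in>{1..}. of_nat n powr (- a) * em_rest 0 b n) =
     (\<Sum>\<^sub>\<infinity>n\<in>{1..}. (\<Sum>k<K. em_coeff k b * of_nat n powr (- (a + b - 1 + of_nat k))) + of_nat n powr (- a) * em_rest K b n)"
  proof (rule infsum_cong)
    fix n :: nat assume "n \<in> {1..}"
    hence n: "n \<ge> 1" by simp
    have "of_nat n powr (- a) * (em_coeff k b * of_nat n powr (1 - b - of_nat k)) =
        em_coeff k b * of_nat n powr (- (a + b - 1 + of_nat k))" for k
      using of_nat_powr_mult[OF n, of "- a" "1 - b - of_nat k"] by (simp add: algebra_simps)
    thus "of_nat n powr (- a) * em_rest 0 b n =
      (\<Sum>k<K. em_coeff k b * of_nat n powr (- (a + b - 1 + of_nat k))) + of_nat n powr (- a) * em_rest K b n"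
      unfolding em_rest_0_eq[OF assms(1) n, of K] distrib_left sum_distrib_left by (simp only:)
  qed
  also have "\<dots> = (\<Sum>k<K. \<Sum>\<^sub>\<infinity>n\<in>{1..}. em_coeff k b * of_nat n powr (- (a + b - 1 + of_nat k))) +
      (\<Sum>\<^sub>\<infinity>n\<in>{1..}. of_nat n powr (- a) * em_rest K b n)"
  proof (subst infsum_add)
    show "(\<lambda>n. of_nat n powr (- a) * em_rest K b n) summable_on {1..}"
      using assms b by (intro em_rest_summable) auto
  qed (use has_sum_imp_summable[OF hs] in \<open>auto intro!: infsum_sum summable_on_cmult_right\<close>)
  also have "\<dots> = em_zeta2 K a b"
    unfolding em_zeta2_def infsum_cmult_right' infsumI[OF hs] by simp
  finally show ?thesis by simp
qed

lemma em_zeta3_series: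
  assumes "(a, b, c) \<in> em_domain 0"
  shows "em_zeta3 K a b c = zeta3_series a b c"
proof -
  have H: "Re c > 1" "Re (b + c) > 2" "Re (a + b + c) > 3" using assms by (auto simp: em_domain_def)
  have c: "c \<noteq> 1" using H by auto
  have s: "b + c - 1 + of_nat k \<noteq> 1" for k
    using regular_setD(2)[of a b c k] em_domain_0_subset assms by blast
  \<comment> \<open>Once the tail over n3 is expanded, the resulting powers of n2 sum to plain tails
    again, now with the exponent b + c - 1 + k; summing these over n1 gives the double
    series.\<close>
  have inner: "(\<Sum>\<^sub>\<infinity>n\<in>{N<..}. of_nat n powr (- b) * em_rest 0 c n) =
      (\<Sum>k<K. em_coeff k c * em_rest 0 (b + c - 1 + of_nat k) N) + (\<Sum>\<^sub>\<infinity>n\<in>{N<..}. of_nat n powr (- b) * em_rest K c n)"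
    if N: "N \<ge> 1" for N
  proof -
    have sm: "(\<lambda>n. of_nat n powr (- (b + c - 1 + of_nat k))) summable_on {N<..}" for k
      using em_term_summable[OF s, of 0 k N] H N by (simp add: em_term_0[abs_def])
    have "(\<Sum>\<^sub>\<infinity>n\<in>{N<..}. of_nat n powr (- b) * em_rest 0 c n) =
     (\<Sum>\<^sub>\<infinity>n\<in>{N<..}. (\<Sum>k<K. em_coeff k c * of_nat n powr (- (b + c - 1 + of_nat k))) + of_nat n powr (- b) * em_rest K c n)"
    proof (rule infsum_cong)
      fix n :: nat assume "n \<in> {N<..}"
      hence n: "n \<ge> 1" by simp
      have "of_nat n powr (- b) * (em_coeff k c * of_nat n powr (1 - c - of_nat k)) =
          em_coeff k c * of_nat n powr (- (b + c - 1 + of_nat k))" for k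
        using of_nat_powr_mult[OF n, of "- b" "1 - c - of_nat k"] by (simp add: algebra_simps)
      thus "of_nat n powr (- b) * em_rest 0 c n =
        (\<Sum>k<K. em_coeff k c * of_nat n powr (- (b + c - 1 + of_nat k))) + of_nat n powr (- b) * em_rest K c n"
        unfolding em_rest_0_eq[OF H(1) n, of K] distrib_left sum_distrib_left by (simp only:)
    qed
    also have "\<dots> = (\<Sum>k<K. \<Sum>\<^sub>\<infinity>n\<in>{N<..}. em_coeff k c * of_nat n powr (- (b + c - 1 + of_nat k))) +
        (\<Sum>\<^sub>\<infinity>n\<in>{N<..}. of_nat n powr (- b) * em_rest K c n)"
    proof (subst infsum_add)
      show "(\<lambda>n. of_nat n powr (- b) * em_rest K c n) summable_on {N<..}"
        using H c N by (intro em_rest_summable) auto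
    qed (use sm in \<open>auto intro!: infsum_sum summable_on_cmult_right\<close>)
    finally show ?thesis
      unfolding infsum_cmult_right' em_rest_def[of 0] em_term_0 .
  qed
  have sm: "(\<lambda>n. of_nat n powr (- a) * em_rest 0 (b + c - 1 + of_nat k) n) summable_on {1..}" for k
    using H s by (intro em_rest_summable) auto
  have "zeta3_series a b c = (\<Sum>\<^sub>\<infinity>n1\<in>{1..}. of_nat n1 powr (- a) * (\<Sum>\<^sub>\<infinity>n\<in>{n1<..}. of_nat n powr (- b) * em_rest 0 c n))"
    unfolding zeta3_series_def em_rest_def em_term_0 ..
  also have "\<dots> = (\<Sum>\<^sub>\<infinity>n1\<in>{1..}. (\<Sum>k<K. em_coeff k c * (of_nat n1 powr (- a) * em_rest 0 (b + c - 1 + of_nat k) n1)) +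
      of_nat n1 powr (- a) * (\<Sum>\<^sub>\<infinity>n\<in>{n1<..}. of_nat n powr (- b) * em_rest K c n))"
  proof (rule infsum_cong)
    fix n1 :: nat assume "n1 \<in> {1..}"
    hence n1: "n1 \<ge> 1" by simp
    show "of_nat n1 powr (- a) * (\<Sum>\<^sub>\<infinity>n\<in>{n1<..}. of_nat n powr (- b) * em_rest 0 c n) =
        (\<Sum>k<K. em_coeff k c * (of_nat n1 powr (- a) * em_rest 0 (b + c - 1 + of_nat k) n1)) +
        of_nat n1 powr (- a) * (\<Sum>\<^sub>\<infinity>n\<in>{n1<..}. of_nat n powr (- b) * em_rest K c n)"
      unfolding inner[OF n1] distrib_left sum_distrib_left by (simp only: mult.left_commute)
  qed
  also have "\<dots> = (\<Sum>k<K. \<Sum>\<^sub>\<infinity>n1\<in>{1..}. em_coeff k c * (of_nat n1 powr (- a) * em_rest 0 (b + c - 1 + of_nat k) n1)) +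
      (\<Sum>\<^sub>\<infinity>n1\<in>{1..}. of_nat n1 powr (- a) * (\<Sum>\<^sub>\<infinity>n\<in>{n1<..}. of_nat n powr (- b) * em_rest K c n))"
  proof (subst infsum_add)
    show "(\<lambda>n1. of_nat n1 powr (- a) * (\<Sum>\<^sub>\<infinity>n\<in>{n1<..}. of_nat n powr (- b) * em_rest K c n)) summable_on {1..}"
      using H c by (intro em_rest_tail_summable) auto
  qed (use sm in \<open>auto intro!: infsum_sum summable_on_cmult_right\<close>)
  finally have 1: "zeta3_series a b c = (\<Sum>k<K. \<Sum>\<^sub>\<infinity>n1\<in>{1..}. em_coeff k c * (of_nat n1 powr (- a) * em_rest 0 (b + c - 1 + of_nat k) n1)) +
      (\<Sum>\<^sub>\<infinity>n1\<in>{1..}. of_nat n1 powr (- a) * (\<Sum>\<^sub>\<infinity>n\<in>{n1<..}. of_nat n powr (- b) * em_rest K c n))" .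
  have *: "(\<Sum>\<^sub>\<infinity>n1\<in>{1..}. em_coeff k c * (of_nat n1 powr (- a) * em_rest 0 (b + c - 1 + of_nat k) n1)) =
      em_coeff k c * em_zeta2 K a (b + c - 1 + of_nat k)" for k
    unfolding infsum_cmult_right' using H by (subst em_zeta2_series) auto
  have "zeta3_series a b c = em_zeta3 K a b c"
    unfolding em_zeta3_def 1 * ..
  thus ?thesis ..
qed

section \<open>Gluing the orders and identification with \<open>zeta3\<close>\<close>

lemma em_domain_exhaust: "\<exists>K. p \<in> em_domain K"
proof -
  obtain a b c where p: "p = (a, b, c)" by (cases p)
  obtain K where K: "real K > 3 + \<bar>Re a\<bar> + \<bar>Re b\<bar> + \<bar>Re c\<bar>"
    using reals_Archimedean2 by blast
  have "Re c > 1 - real K" "Re b + Re c > 2 - real K" "Re a + Re b + Re c > 3 - real K"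
    using K by linarith+
  thus ?thesis unfolding p em_domain_def by auto
qed

lemma two_mem_em_domain_0: "(2, 2, 2) \<in> em_domain 0"
  by (simp add: em_domain_def)

lemma em_zeta3_unique:
  assumes "p \<in> em_domain K" "p \<in> em_domain L" "p \<in> regular_set"
  shows "em_zeta3 K (fst p) (fst (snd p)) (snd (snd p)) = em_zeta3 L (fst p) (fst (snd p)) (snd (snd p))"
proof (rule holomorphic3_identity[where f = "\<lambda>p. em_zeta3 K (fst p) (fst (snd p)) (snd (snd p))"
      and g = "\<lambda>p. em_zeta3 L (fst p) (fst (snd p)) (snd (snd p))"
      and S = "em_domain (min K L) \<inter> regular_set" and W = "em_domain 0"])
  have sub: "em_domain (min K L) \<subseteq> em_domain K" "em_domain (min K L) \<subseteq> em_domain L"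
    by (intro em_domain_mono; simp)+
  show "holomorphic3_on (\<lambda>p. em_zeta3 K (fst p) (fst (snd p)) (snd (snd p))) (em_domain (min K L) \<inter> regular_set)"
    by (rule holomorphic3_on_subset[OF holomorphic3_em_zeta3]) (use sub in blast)
  show "holomorphic3_on (\<lambda>p. em_zeta3 L (fst p) (fst (snd p)) (snd (snd p))) (em_domain (min K L) \<inter> regular_set)"
    by (rule holomorphic3_on_subset[OF holomorphic3_em_zeta3]) (use sub in blast)
  show "open (em_domain (min K L) \<inter> regular_set)"
    by (intro open_Int open_em_domain open_regular_set)
  show "connected (em_domain (min K L) \<inter> regular_set)"
    by (intro connected_convex_Int_regular convex_em_domain open_em_domain)
  show "open (em_domain 0)" by (rule open_em_domain)
  show "em_domain 0 \<noteq> {}" using two_mem_em_domain_0 by blast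
  show "em_domain 0 \<subseteq> em_domain (min K L) \<inter> regular_set"
    using em_domain_0_subset em_domain_mono[of 0 "min K L"] by blast
  show "p \<in> em_domain (min K L) \<inter> regular_set"
    using assms by (auto simp: min_def)
  show "em_zeta3 K (fst q) (fst (snd q)) (snd (snd q)) = em_zeta3 L (fst q) (fst (snd q)) (snd (snd q))"
    if "q \<in> em_domain 0" for q
    using that em_zeta3_series[of "fst q" "fst (snd q)" "snd (snd q)"] by simp
qed

text \<open>The order picked may jump from point to point. At regular points all admissible orders
  give the same value, so locally one order can be fixed.\<close>

definition zeta3_cont :: "complex \<times> complex \<times> complex \<Rightarrow> complex" where
  "zeta3_cont p = em_zeta3 (SOME K. p \<in> em_domain K) (fst p) (fst (snd p)) (snd (snd p))"

lemma zeta3_cont_eq: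
  assumes "p \<in> em_domain K" "p \<in> regular_set"
  shows "zeta3_cont p = em_zeta3 K (fst p) (fst (snd p)) (snd (snd p))"
  unfolding zeta3_cont_def by (rule em_zeta3_unique[OF someI_ex[OF em_domain_exhaust] assms])

lemma holomorphic3_on_local:
  assumes "\<And>p. p \<in> U \<Longrightarrow> \<exists>T. open T \<and> p \<in> T \<and> holomorphic3_on f T"
  shows "holomorphic3_on f U"
  unfolding holomorphic3_on_def
proof
  show "continuous_on U f"
  proof (rule continuous_at_imp_continuous_on, rule ballI)
    fix p assume "p \<in> U"
    then obtain T where T: "open T" "p \<in> T" "holomorphic3_on f T" using assms by blast
    show "isCont f p"
      by (rule continuous_on_eq_continuous_at[THEN iffD1, OF T(1) holomorphic3_on_imp_continuous_on[OF T(3)], rule_format, OF T(2)])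
  qed
  show "\<forall>(a, b, c)\<in>U. (\<lambda>z. f (z, b, c)) field_differentiable at a \<and>
                    (\<lambda>z. f (a, z, c)) field_differentiable at b \<and>
                    (\<lambda>z. f (a, b, z)) field_differentiable at c"
  proof (rule ballI)
    fix p assume "p \<in> U"
    then obtain T where T: "p \<in> T" "holomorphic3_on f T" using assms by blast
    show "case p of (a, b, c) \<Rightarrow> (\<lambda>z. f (z, b, c)) field_differentiable at a \<and>
          (\<lambda>z. f (a, z, c)) field_differentiable at b \<and> (\<lambda>z. f (a, b, z)) field_differentiable at c"
      by (rule bspec[OF T(2)[unfolded holomorphic3_on_def, THEN conjunct2] T(1)])
  qed
qed

lemma holomorphic3_zeta3_cont: "holomorphic3_on zeta3_cont regular_set"
proof (rule holomorphic3_on_local)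
  fix p assume p: "p \<in> regular_set"
  obtain K where K: "p \<in> em_domain K" using em_domain_exhaust by blast
  have o: "open (em_domain K \<inter> regular_set)" by (intro open_Int open_em_domain open_regular_set)
  have "holomorphic3_on zeta3_cont (em_domain K \<inter> regular_set)"
  proof (rule holomorphic3_on_cong[OF o, THEN iffD2, OF _ holomorphic3_em_zeta3])
    fix q assume "q \<in> em_domain K \<inter> regular_set"
    thus "zeta3_cont q = em_zeta3 K (fst q) (fst (snd q)) (snd (snd q))"
      by (intro zeta3_cont_eq) simp_all
  qed
  thus "\<exists>T. open T \<and> p \<in> T \<and> holomorphic3_on zeta3_cont T" using o p K by blast
qed

lemma zeta3_domain_subset: "zeta3_domain \<subseteq> em_domain 0"
  by (auto simp: zeta3_domain_def em_domain_def)

lemma zeta3_cont_series: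
  assumes "(a, b, c) \<in> zeta3_domain"
  shows "zeta3_cont (a, b, c) = zeta3_series a b c"
proof -
  have d: "(a, b, c) \<in> em_domain 0" using assms zeta3_domain_subset by blast
  hence "(a, b, c) \<in> regular_set" using em_domain_0_subset by blast
  from zeta3_cont_eq[OF d this] show ?thesis using em_zeta3_series[OF d] by simp
qed

lemma zeta3_eq:
  assumes "(a, b, c) \<in> regular_set"
  shows "zeta3 a b c = zeta3_cont (a, b, c)"
  unfolding zeta3_def
proof (rule the_equality)
  have "connected regular_set"
    using connected_convex_Int_regular[of UNIV] by simp
  moreover have "zeta3_domain \<subseteq> regular_set"
    using zeta3_domain_subset em_domain_0_subset by blast
  ultimately show "\<exists>U g. open U \<and> connected U \<and> zeta3_domain \<subseteq> U \<and> (a, b, c) \<in> U \<and>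
     holomorphic3_on g U \<and>
     (\<forall>(t1, t2, t3)\<in>zeta3_domain. g (t1, t2, t3) = zeta3_series t1 t2 t3) \<and>
     zeta3_cont (a, b, c) = g (a, b, c)"
    using assms open_regular_set holomorphic3_zeta3_cont zeta3_cont_series
    by (intro exI[of _ regular_set] exI[of _ zeta3_cont]) auto
next
  fix v assume "\<exists>U g. open U \<and> connected U \<and> zeta3_domain \<subseteq> U \<and> (a, b, c) \<in> U \<and>
     holomorphic3_on g U \<and>
     (\<forall>(t1, t2, t3)\<in>zeta3_domain. g (t1, t2, t3) = zeta3_series t1 t2 t3) \<and> v = g (a, b, c)"
  then obtain U g where U: "open U" "connected U" "zeta3_domain \<subseteq> U" "(a, b, c) \<in> U" "holomorphic3_on g U"
    "\<forall>(t1, t2, t3)\<in>zeta3_domain. g (t1, t2, t3) = zeta3_series t1 t2 t3" "v = g (a, b, c)"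
    by blast
  \<comment> \<open>The set \<open>zeta3_domain\<close> is not open because of its weak
    inequalities; W is an open part of it from which the identity theorem can start.\<close>
  define W where "W = {z::complex. Re z > 1} \<times> {z::complex. Re z > 1} \<times> {z::complex. Re z > 1}"
  have W: "W \<subseteq> zeta3_domain" by (auto simp: W_def zeta3_domain_def)
  have "g (a, b, c) = zeta3_cont (a, b, c)"
  proof (rule regular_set_continuation_unique[OF U(5) holomorphic3_zeta3_cont U(1,2)])
    show "open W" unfolding W_def by (intro open_Times open_halfspace_Re_gt)
    have "(2, 2, 2) \<in> W" by (simp add: W_def)
    thus "W \<noteq> {}" by blast
    show "W \<subseteq> U" using W U(3) by (rule subset_trans)
    show "(a, b, c) \<in> U" "(a, b, c) \<in> regular_set" by fact+
    fix p assume p: "p \<in> W"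
    obtain x y z where xyz: "p = (x, y, z)" by (cases p)
    hence "(x, y, z) \<in> zeta3_domain" using p W by blast
    thus "g p = zeta3_cont p" using U(6) zeta3_cont_series unfolding xyz by fastforce
  qed
  thus "v = zeta3_cont (a, b, c)" using U by simp
qed

subsection \<open>Values at non-positive integers\<close>

lemma em_zeta2_neg_nat:
  assumes "K \<ge> p + 2"
  shows "em_zeta2 K x (- of_nat p) =
    - (\<Sum>k=0..p+1. of_nat ((p + 1) choose k) * (bernpoly k 1 / of_nat (p + 1)) * riemann_zeta (x - of_nat (p + 1 - k)))"
proof -
  have "em_zeta2 K x (- of_nat p) = (\<Sum>k<K. em_coeff k (- of_nat p) * riemann_zeta (x + (- of_nat p) - 1 + of_nat k))"
    unfolding em_zeta2_def using assms by (auto intro!: infsum_0 em_rest_neg_nat_eq_0)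
  also have "\<dots> = (\<Sum>k=0..p+1. em_coeff k (- of_nat p) * riemann_zeta (x + (- of_nat p) - 1 + of_nat k))"
    by (rule sum.mono_neutral_right) (use assms in \<open>auto simp: em_coeff_neg_nat\<close>)
  also have "\<dots> = (\<Sum>k=0..p+1. - (of_nat ((p + 1) choose k) * (bernpoly k 1 / of_nat (p + 1)) * riemann_zeta (x - of_nat (p + 1 - k))))"
  proof (rule sum.cong[OF refl])
    fix k assume "k \<in> {0..p+1}"
    hence "x + (- of_nat p) - 1 + of_nat k = x - of_nat (p + 1 - k)" by (simp add: of_nat_diff)
    thus "em_coeff k (- of_nat p) * riemann_zeta (x + (- of_nat p) - 1 + of_nat k) =
      - (of_nat ((p + 1) choose k) * (bernpoly k 1 / of_nat (p + 1)) * riemann_zeta (x - of_nat (p + 1 - k)))"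
      unfolding em_coeff_neg_nat by (simp only: mult_minus_left)
  qed
  finally show ?thesis unfolding sum_negf .
qed

text \<open>Here y stays free. The terms with k > m + 1 drop out because their coefficients vanish,
  and with them go the singularities that would obstruct the limit in y.\<close>

lemma em_zeta3_neg_nat:
  assumes "K \<ge> m + 2"
  shows "em_zeta3 K x y (- of_nat m) =
    - (\<Sum>k=0..m+1. of_nat ((m + 1) choose k) * (bernpoly k 1 / of_nat (m + 1)) * em_zeta2 K x (y - of_nat m - 1 + of_nat k))"
proof -
  have 0: "(\<Sum>\<^sub>\<infinity>n2\<in>{n1<..}. of_nat n2 powr (- y) * em_rest K (- of_nat m) n2) = 0" if "n1 \<in> {1..}" for n1
    using that assms by (intro infsum_0) (auto simp: em_rest_neg_nat_eq_0)
  have "em_zeta3 K x y (- of_nat m) = (\<Sum>k<K. em_coeff k (- of_nat m) * em_zeta2 K x (y + (- of_nat m) - 1 + of_nat k))"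
    unfolding em_zeta3_def using 0 by (subst infsum_0[of "{1..}"]) auto
  also have "\<dots> = (\<Sum>k=0..m+1. em_coeff k (- of_nat m) * em_zeta2 K x (y + (- of_nat m) - 1 + of_nat k))"
    by (rule sum.mono_neutral_right) (use assms in \<open>auto simp: em_coeff_neg_nat\<close>)
  finally show ?thesis
    unfolding em_coeff_neg_nat sum_negf[symmetric] mult_minus_left by simp
qed

text \<open>The three-variable result is reused with y as first coordinate and the other two idle.
  Non-integrality of x + y0 keeps all arguments of the zeta function away from 1.\<close>

lemma em_zeta2_tendsto:
  assumes "y0 \<noteq> 1" "Re y0 > 1 - real K" "Re x + Re y0 > 2 - real K" "x + y0 \<notin> \<int>"
  shows "(em_zeta2 K x \<longlongrightarrow> em_zeta2 K x y0) (nhds y0)"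
proof -
  define U :: "(complex \<times> complex \<times> complex) set" where
    "U = {p. fst p \<noteq> 1 \<and> Re (fst p) > 1 - real K \<and> Re x + Re (fst p) > 2 - real K \<and> x + fst p \<in> - \<int>}"
  have "open ((\<lambda>p::complex \<times> complex \<times> complex. x + fst p) -` (- \<int>))"
    by (intro open_vimage continuous_intros) (simp add: open_Compl closed_Ints)
  hence "open {p::complex \<times> complex \<times> complex. x + fst p \<in> - \<int>}" by (simp add: vimage_def)
  hence U: "open U" unfolding U_def
    by (intro open_Collect_conj open_Collect_neq open_Collect_less continuous_intros)
  have h: "holomorphic3_on (\<lambda>p. em_zeta2 K x (fst p)) U"
  proof (rule holomorphic3_em_zeta2[OF U holomorphic3_const[OF U, of x] holomorphic3_proj(1)[OF U]])
    fix p k assume "p \<in> U" "k < K"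
    hence "x + fst p \<notin> \<int>" by (simp add: U_def)
    moreover have "x + fst p \<in> \<int>" if "x + fst p - 1 + of_nat k = 1"
    proof -
      have "x + fst p = 2 - of_nat k" using that by (simp add: algebra_simps)
      thus ?thesis by simp
    qed
    ultimately show "x + fst p - 1 + of_nat k \<noteq> 1" by blast
  qed (simp_all add: U_def)
  have y: "(y0, 0, 0) \<in> U" using assms by (simp add: U_def)
  have "((\<lambda>p. em_zeta2 K x (fst p)) \<longlongrightarrow> em_zeta2 K x (fst (y0, 0::complex, 0::complex))) (nhds (y0, 0::complex, 0::complex))"
    by (rule continuous_on_open_tendsto_nhds[OF holomorphic3_on_imp_continuous_on[OF h] U y])
  moreover have "((\<lambda>y. (y, 0, 0)) \<longlongrightarrow> (y0, 0::complex, 0::complex)) (nhds y0)"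
    by (intro tendsto_Pair tendsto_const filterlim_ident)
  ultimately have "((\<lambda>y. em_zeta2 K x (fst (y, 0::complex, 0::complex))) \<longlongrightarrow>
      em_zeta2 K x (fst (y0, 0::complex, 0::complex))) (nhds y0)"
    by (rule filterlim_compose)
  thus ?thesis by simp
qed

lemma eventually_at_not_Ints: "\<forall>\<^sub>F x in at z. x \<notin> (\<int> :: complex set)"
proof (cases "z \<in> \<int>")
  case True
  show ?thesis unfolding eventually_at
  proof (intro exI[of _ 1] conjI ballI impI)
    fix x assume x: "x \<noteq> z \<and> dist x z < 1"
    show "x \<notin> \<int>"
    proof
      assume "x \<in> \<int>"
      with True obtain i j where ij: "x = of_int i" "z = of_int j" by (auto elim!: Ints_cases)
      have "\<bar>real_of_int (i - j)\<bar> < 1"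
        using x unfolding ij dist_norm of_int_diff[symmetric] norm_of_int by simp
      hence "\<bar>i - j\<bar> < 1" unfolding of_int_abs[symmetric] by simp
      thus False using x ij by simp
    qed
  qed auto
next
  case False
  have "\<forall>\<^sub>F x in nhds z. x \<in> - \<int>"
    by (rule eventually_nhds_in_open) (use False closed_Ints in auto)
  thus ?thesis by (auto simp: eventually_at_filter elim: eventually_mono)
qed

text \<open>Inner limits exist only eventually and \<open>Lim\<close> may be junk elsewhere; the
  outer limits see only the punctured neighbourhoods where the values are right.\<close>

lemma has_iterated_limit_imp_Lim:
  assumes "has_iterated_limit f a b c L"
  shows "Lim (at a) (\<lambda>x. Lim (at b) (\<lambda>y. Lim (at c) (\<lambda>z. f x y z))) = L"
proof -
  obtain g h where gh: "\<forall>\<^sub>F x in at a. \<forall>\<^sub>F y in at b. ((\<lambda>z. f x y z) \<longlongrightarrow> g x y) (at c)"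
    "\<forall>\<^sub>F x in at a. ((\<lambda>y. g x y) \<longlongrightarrow> h x) (at b)" "(h \<longlongrightarrow> L) (at a)"
    using assms unfolding has_iterated_limit_def by blast
  have "\<forall>\<^sub>F x in at a. h x = Lim (at b) (\<lambda>y. Lim (at c) (\<lambda>z. f x y z))"
    using gh(1,2)
  proof eventually_elim
    case (elim x)
    have "\<forall>\<^sub>F y in at b. g x y = Lim (at c) (\<lambda>z. f x y z)"
      using elim(1) by eventually_elim (rule tendsto_Lim[symmetric], simp_all)
    with elim(2) have "((\<lambda>y. Lim (at c) (\<lambda>z. f x y z)) \<longlongrightarrow> h x) (at b)"
      by (rule Lim_transform_eventually)
    thus ?case by (intro tendsto_Lim[symmetric]) simp_all
  qed
  with gh(3) have "((\<lambda>x. Lim (at b) (\<lambda>y. Lim (at c) (\<lambda>z. f x y z))) \<longlongrightarrow> L) (at a)"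
    by (rule Lim_transform_eventually)
  thus ?thesis by (intro tendsto_Lim) simp_all
qed

lemma zeta3_tendsto:
  assumes "(a, b, c) \<in> regular_set"
  shows "(zeta3 a b \<longlongrightarrow> zeta3 a b c) (at c)"
proof -
  have l: "((\<lambda>z. (a, b, z)) \<longlongrightarrow> (a, b, c)) (nhds c)"
    by (intro tendsto_Pair tendsto_const filterlim_ident)
  have "(zeta3_cont \<longlongrightarrow> zeta3_cont (a, b, c)) (nhds (a, b, c))"
    using holomorphic3_on_imp_continuous_on[OF holomorphic3_zeta3_cont] open_regular_set assms
    by (rule continuous_on_open_tendsto_nhds)
  hence "((\<lambda>z. zeta3_cont (a, b, z)) \<longlongrightarrow> zeta3_cont (a, b, c)) (nhds c)"
    by (rule filterlim_compose[OF _ l])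
  moreover have "\<forall>\<^sub>F z in nhds c. zeta3_cont (a, b, z) = zeta3 a b z"
    using eventually_compose_filterlim[OF eventually_nhds_in_open[OF open_regular_set assms] l]
    by eventually_elim (simp add: zeta3_eq)
  ultimately have "(zeta3 a b \<longlongrightarrow> zeta3_cont (a, b, c)) (nhds c)"
    by (rule Lim_transform_eventually)
  thus ?thesis using zeta3_eq[OF assms] by (simp add: tendsto_mono[OF at_within_le_nhds])
qed

theorem mainTheorem1:
  fixes s1 :: complex and m2 m3 :: nat
  assumes "Re s1 \<le> 0 \<or> (Re s1 > 0 \<and> s1 \<notin> \<int>)"
  shows "has_iterated_limit zeta3 s1 (- of_nat m2) (- of_nat m3) (zeta3_nonpos s1 m2 m3) \<and>
    zeta3_nonpos s1 m2 m3 =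
      (\<Sum>k3 = 0..m3 + 1. of_nat ((m3 + 1) choose k3) * (bernpoly k3 1 / of_nat (m3 + 1)) *
        (\<Sum>k2 = 0..m2 + m3 + 2 - k3.
           of_nat ((m2 + m3 + 2 - k3) choose k2) * (bernpoly k2 1 / of_nat (m2 + m3 + 2 - k3)) *
           riemann_zeta (s1 - of_nat (m2 + m3 + 2 - k2 - k3))))"
proof -
  define h where "h = (\<lambda>x. \<Sum>k3 = 0..m3 + 1. of_nat ((m3 + 1) choose k3) * (bernpoly k3 1 / of_nat (m3 + 1)) *
        (\<Sum>k2 = 0..m2 + m3 + 2 - k3.
           of_nat ((m2 + m3 + 2 - k3) choose k2) * (bernpoly k2 1 / of_nat (m2 + m3 + 2 - k3)) *
           riemann_zeta (x - of_nat (m2 + m3 + 2 - k2 - k3))))"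
  \<comment> \<open>The excluded case would make s1 a positive integer, which both alternatives of
    the hypothesis rule out.\<close>
  have pole: "s1 - of_nat N \<noteq> 1" for N
  proof
    assume "s1 - of_nat N = 1"
    hence "s1 = of_nat (N + 1)" by (simp add: algebra_simps)
    thus False using assms by (auto simp del: of_nat_add)
  qed
  have "(h \<longlongrightarrow> h s1) (at s1)"
  proof -
    have "((\<lambda>x. riemann_zeta (x - of_nat N)) \<longlongrightarrow> riemann_zeta (s1 - of_nat N)) (at s1)" for N
    proof -
      have "isCont riemann_zeta (s1 - of_nat N)"
        using holomorphic_on_imp_continuous_on[OF holomorphic_riemann_zeta] pole[of N]
        by (simp add: continuous_on_eq_continuous_at open_Compl)
      thus ?thesis by (rule isCont_tendsto_compose) (intro tendsto_intros)
    qed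
    thus ?thesis unfolding h_def by (intro tendsto_sum tendsto_mult tendsto_const)
  qed
  \<comment> \<open>At y = -m2 the point is polar, so y must avoid the integers. The third
    hyperplane family is avoided because x - m2 - m3 is not an integer and the integers are
    closed.\<close>
  moreover have reg: "\<forall>\<^sub>F y in at (- of_nat m2). (x, y, - of_nat m3) \<in> regular_set" if x: "x \<notin> \<int>" for x
  proof -
    have "\<forall>\<^sub>F y in at (- of_nat m2). x + y + (- of_nat m3) \<in> - \<int>"
    proof (rule topological_tendstoD)
      show "((\<lambda>y. x + y + (- of_nat m3)) \<longlongrightarrow> x + (- of_nat m2) + (- of_nat m3)) (at (- of_nat m2))"
        by (intro tendsto_intros)
      show "open (- \<int> :: complex set)" using closed_Ints by (rule open_Compl)
      have "x \<in> \<int>" if "x + (- of_nat m2) + (- of_nat m3) \<in> \<int>"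
      proof -
        have "x = (x + (- of_nat m2) + (- of_nat m3)) + of_nat (m2 + m3)" by simp
        also have "\<dots> \<in> \<int>" by (rule Ints_add[OF that Ints_of_nat])
        finally show ?thesis .
      qed
      thus "x + (- of_nat m2) + (- of_nat m3) \<in> - \<int>" using x by blast
    qed
    moreover have "\<forall>\<^sub>F y in at (- of_nat m2). y \<notin> (\<int> :: complex set)" by (rule eventually_at_not_Ints)
    ultimately show ?thesis
    proof eventually_elim
      case (elim y)
      have nonpos: "z \<in> \<int>" if "z \<in> \<int>\<^sub>\<le>\<^sub>0" for z :: complex
        using that by (auto elim: nonpos_Ints_cases)
      have 1: "- of_nat m3 \<noteq> (1 :: complex)" by (rule neg_of_nat_neq_1)
      have 2: "y + - of_nat m3 - 2 \<notin> \<int>\<^sub>\<le>\<^sub>0"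
      proof
        assume "y + - of_nat m3 - 2 \<in> \<int>\<^sub>\<le>\<^sub>0"
        hence "(y + - of_nat m3 - 2) + of_nat m3 + 2 \<in> \<int>"
          by (rule Ints_add[OF Ints_add[OF nonpos Ints_of_nat] Ints_numeral])
        thus False using elim by simp
      qed
      have 3: "x + y + - of_nat m3 - 3 \<notin> \<int>\<^sub>\<le>\<^sub>0"
      proof
        assume "x + y + - of_nat m3 - 3 \<in> \<int>\<^sub>\<le>\<^sub>0"
        hence "(x + y + - of_nat m3 - 3) + 3 \<in> \<int>"
          by (rule Ints_add[OF nonpos Ints_numeral])
        thus False using elim by simp
      qed
      show ?case unfolding regular_set_iff using 1 2 3 by blast
    qed
  qed
  have "\<forall>\<^sub>F x in at s1. \<forall>\<^sub>F y in at (- of_nat m2).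
      ((\<lambda>z. zeta3 x y z) \<longlongrightarrow> zeta3 x y (- of_nat m3)) (at (- of_nat m3))"
    using eventually_at_not_Ints[of s1]
  proof eventually_elim
    case (elim x)
    from reg[OF elim] show ?case by eventually_elim (rule zeta3_tendsto)
  qed
  moreover have "\<forall>\<^sub>F x in at s1. ((\<lambda>y. zeta3 x y (- of_nat m3)) \<longlongrightarrow> h x) (at (- of_nat m2))"
    using eventually_at_not_Ints[of s1]
  proof eventually_elim
    case (elim x)
    \<comment> \<open>Large enough that (x, y, -m3) lies in \<open>em_domain K\<close> whenever Re y
      > -m2 - 1, and that the remainders vanish at all non-positive integers that occur.\<close>
    define K where "K = nat \<lceil>\<bar>Re x\<bar>\<rceil> + m2 + m3 + 5"
    have K: "real K \<ge> \<bar>Re x\<bar> + real m2 + real m3 + 5" by (simp add: K_def)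
    define H where "H = (\<lambda>y. - (\<Sum>k=0..m3+1. of_nat ((m3 + 1) choose k) * (bernpoly k 1 / of_nat (m3 + 1)) *
       em_zeta2 K x (y - of_nat m3 - 1 + of_nat k)))"
    \<comment> \<open>For k \<le> m3 + 1 the limiting second argument is at most -m2, hence away
      from the pole at 1 of the coefficients of \<open>em_zeta2\<close>.\<close>
    have val: "- of_nat m2 - of_nat m3 - 1 + of_nat k = (- of_nat (m2 + m3 + 1 - k) :: complex)"
      if "k \<le> m3 + 1" for k using that by (simp add: of_nat_diff)
    have "((\<lambda>y. em_zeta2 K x (y - of_nat m3 - 1 + of_nat k)) \<longlongrightarrow> em_zeta2 K x (- of_nat (m2 + m3 + 1 - k))) (at (- of_nat m2))"
      if k: "k \<in> {0..m3+1}" for k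
    proof (rule filterlim_compose[OF em_zeta2_tendsto])
      show "- of_nat (m2 + m3 + 1 - k) \<noteq> (1::complex)"
        by (rule neg_of_nat_neq_1)
      have *: "real (m2 + m3 + 1 - k) \<le> real m2 + real m3 + 1" by linarith
      show "Re (- of_nat (m2 + m3 + 1 - k)) > 1 - real K" "Re x + Re (- of_nat (m2 + m3 + 1 - k)) > 2 - real K"
        using K * by simp_all
      show "x + - of_nat (m2 + m3 + 1 - k) \<notin> \<int>"
      proof
        assume "x + - of_nat (m2 + m3 + 1 - k) \<in> \<int>"
        hence "x + - of_nat (m2 + m3 + 1 - k) + of_nat (m2 + m3 + 1 - k) \<in> \<int>"
          by (rule Ints_add[OF _ Ints_of_nat])
        thus False using elim by simp
      qed
      show "((\<lambda>y::complex. y - of_nat m3 - 1 + of_nat k) \<longlongrightarrow> - of_nat (m2 + m3 + 1 - k)) (at (- of_nat m2))"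
        unfolding val[of k, symmetric, OF k[unfolded atLeastAtMost_iff, THEN conjunct2]]
        by (intro tendsto_intros)
    qed
    hence "(H \<longlongrightarrow> - (\<Sum>k=0..m3+1. of_nat ((m3 + 1) choose k) * (bernpoly k 1 / of_nat (m3 + 1)) *
       em_zeta2 K x (- of_nat (m2 + m3 + 1 - k)))) (at (- of_nat m2))"
      unfolding H_def by (intro tendsto_minus tendsto_sum tendsto_mult tendsto_const)
    also have "- (\<Sum>k=0..m3+1. of_nat ((m3 + 1) choose k) * (bernpoly k 1 / of_nat (m3 + 1)) *
       em_zeta2 K x (- of_nat (m2 + m3 + 1 - k))) = h x"
      unfolding h_def sum_negf[symmetric]
    proof (rule sum.cong[OF refl])
      fix k assume k: "k \<in> {0..m3+1}"
      have e: "m2 + m3 + 1 - k + 1 = m2 + m3 + 2 - k" using k by auto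
      have "em_zeta2 K x (- of_nat (m2 + m3 + 1 - k)) = - (\<Sum>k2 = 0..m2 + m3 + 2 - k.
           of_nat ((m2 + m3 + 2 - k) choose k2) * (bernpoly k2 1 / of_nat (m2 + m3 + 2 - k)) *
           riemann_zeta (x - of_nat (m2 + m3 + 2 - k - k2)))"
        by (subst em_zeta2_neg_nat) (simp add: K_def, simp only: e)
      thus "- (of_nat ((m3 + 1) choose k) * (bernpoly k 1 / of_nat (m3 + 1)) *
          em_zeta2 K x (- of_nat (m2 + m3 + 1 - k))) =
        of_nat ((m3 + 1) choose k) * (bernpoly k 1 / of_nat (m3 + 1)) *
        (\<Sum>k2 = 0..m2 + m3 + 2 - k.
           of_nat ((m2 + m3 + 2 - k) choose k2) * (bernpoly k2 1 / of_nat (m2 + m3 + 2 - k)) *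
           riemann_zeta (x - of_nat (m2 + m3 + 2 - k2 - k)))"
        by (simp only: mult_minus_right minus_minus diff_commute[of _ k])
    qed
    finally have "(H \<longlongrightarrow> h x) (at (- of_nat m2))" .
    moreover have "\<forall>\<^sub>F y in at (- of_nat m2). H y = zeta3 x y (- of_nat m3)"
    proof -
      have "\<forall>\<^sub>F y in nhds (- of_nat m2). - real m2 - 1 < Re y"
        by (rule eventually_nhds_Re_greater) simp
      hence "\<forall>\<^sub>F y in at (- of_nat m2). - real m2 - 1 < Re y"
        by (rule filter_leD[OF at_within_le_nhds])
      with reg[OF elim] show ?thesis
      proof eventually_elim
        case (elim y)
        have "1 - real K < - real m3" "2 - real K < Re y - real m3" "3 - real K < Re x + Re y - real m3"
          using K elim(2) abs_ge_minus_self[of "Re x"] by linarith+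
        hence "(x, y, - of_nat m3) \<in> em_domain K"
          by (simp add: em_domain_def)
        hence "zeta3 x y (- of_nat m3) = em_zeta3 K x y (- of_nat m3)"
          using zeta3_eq[OF elim(1)] zeta3_cont_eq[OF _ elim(1)] by simp
        also have "\<dots> = H y" unfolding H_def by (rule em_zeta3_neg_nat) (simp add: K_def)
        finally show ?case ..
      qed
    qed
    ultimately show ?case by (rule Lim_transform_eventually)
  qed
  ultimately have lim: "has_iterated_limit zeta3 s1 (- of_nat m2) (- of_nat m3) (h s1)"
    unfolding has_iterated_limit_def
    by (intro exI[of _ "\<lambda>x y. zeta3 x y (- of_nat m3)"] exI[of _ h] conjI)
  hence "zeta3_nonpos s1 m2 m3 = h s1"
    unfolding zeta3_nonpos_def by (rule has_iterated_limit_imp_Lim)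
  thus ?thesis using lim unfolding h_def by simp
qed

end
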